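(* Let $A_1,A_2$ be real $2\times2$ matrices with $A_i=P_iJ_iP_i^{-1}$, $P_i$ real invertible, $J_1=\begin{pmatrix}-n_1&1\\0&-n_1\end{pmatrix}$ with $n_1>0$, $J_2=\mathrm{diag}(-p_2,-q_2)$ with $0<p_2<q_2$, where $P_1,P_2$ are chosen so that $M=P_2^{-1}P_1=\begin{pmatrix}a&b\\c&d\end{pmatrix}$ has $\det M=1$. Define $\tau_{2,1}\ge0$ as follows. (i) If $|ac|\le n_1$, the switched system $\dot x(t)=A_{\sigma(t)}x(t)$ is stable for all signals $\sigma$; let $\tau_{2,1}=0$. (ii) If $|ac|>n_1$, let $(t,s)=(t_0,S(t_0))$ be the unique solution with $t,s>0$ of the system $$act\cosh\left(\tfrac{q_2-p_2}{2}s\right)=\sinh\left(\tfrac{q_2-p_2}{2}s\right)+\mathrm{sgn}(ac)\sinh\left(\tfrac{q_2+p_2}{2}s+n_1t\right),$$ $$t=-\left(\frac{q_2+p_2}{2n_1}\right)s+\frac1{n_1}\cosh^{-1}\left(\frac{|ac|}{n_1}\cosh\left(\tfrac{q_2-p_2}{2}s\right)\right).$$ (a) If $S(t_0)\le t_0$, let $\tau_{2,1}=S(t_0)$. (b) If $S(t_0)>t_0$, let $\tau_{2,1}$ be the unique solution $t\in(t_0,\infty)$ of $$act\cosh\left(\tfrac{q_2-p_2}{2}t\right)=\sinh\left(\tfrac{q_2-p_2}{2}t\right)+\mathrm{sgn}(ac)\sinh\left(\left(\tfrac{q_2+p_2}{2}+n_1\right)t\right).$$ Then the switched system $\dot x(t)=A_{\sigma(t)}x(t)$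 is stable for all $\sigma\in S_{\tau_{2,1}}$ and asymptotically stable for all $\sigma\in S'_{\tau_{2,1}}$.
   Context: A signal is a right-continuous piecewise constant $\sigma:[0,\infty)\to\{1,2\}$ with $\sigma(0)=1$ and infinitely many discontinuities $0=d_0<d_1<d_2<\cdots$, $d_k\to\infty$. For $j\ge1$, $t_j=d_{2j-1}-d_{2j-2}>0$ and $s_j=d_{2j}-d_{2j-1}>0$ are the successive times spent in subsystems $A_1$ and $A_2$. For fixed $\sigma$ the system $\dot x(t)=A_{\sigma(t)}x(t)$ on $\mathbb R^2$ is stable if for every $\epsilon>0$ there is $\delta>0$ such that $\|x(0)\|<\delta$ implies $\|x(t)\|<\epsilon$ for all $t>0$; it is asymptotically stable if it is stable and $\|x(t)\|\to0$ as $t\to\infty$ for every $x(0)$. For $\tau\ge 0$: $S_\tau$ is the set of signals with $t_j\ge\tau$ and $s_j\ge\tau$ for all $j\in\mathbb N$; $S'_\tau$ is the set of $\sigma\in S_\tau$ for which there is an infinite subset $\Gamma\subset\mathbb N$ such that $(\tau,\tau)$ is not a limit (cluster) point of the sequence $(t_\gamma,s_\gamma)_{\gamma\in\Gamma}$. $\mathrm{sgn}$ is the sign function and $\cosh^{-1}:[1,\infty)\to[0,\infty)$. *)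

theory Defs
  imports "HOL-Analysis.Analysis"
begin

(* A signal together with its discontinuities d 0 < d 1 < ...; the initial time
   d 0 = 0 is counted as a discontinuity by convention.  Only the values of sigma
   on {0..} matter, and d is determined by sigma.  The topology on nat is discrete. *)
definition signal_with :: "(real \<Rightarrow> nat) \<Rightarrow> (nat \<Rightarrow> real) \<Rightarrow> bool" where
  "signal_with \<sigma> d \<longleftrightarrow>
     \<sigma> 0 = 1 \<and>
     (\<forall>t\<ge>0. \<sigma> t \<in> {1, 2}) \<and>
     (\<forall>t\<ge>0. continuous (at_right t) \<sigma>) \<and>
     d 0 = 0 \<and> strict_mono d \<and> filterlim d at_top sequentially \<and>
     {t. 0 < t \<and> \<not> isCont \<sigma> t} = d ` {1..} \<and>
     (\<forall>k. \<sigma> constant_on {d k<..<d (Suc k)})"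

definition signals :: "(real \<Rightarrow> nat) set" where
  "signals = {\<sigma>. \<exists>d. signal_with \<sigma> d}"

(* Times spent in the first and second subsystem during the j-th loop, j \<ge> 1. *)
definition stay1 :: "(nat \<Rightarrow> real) \<Rightarrow> nat \<Rightarrow> real" where
  "stay1 d j = d (2 * j - 1) - d (2 * j - 2)"

definition stay2 :: "(nat \<Rightarrow> real) \<Rightarrow> nat \<Rightarrow> real" where
  "stay2 d j = d (2 * j) - d (2 * j - 1)"

definition dwell_signals :: "real \<Rightarrow> (real \<Rightarrow> nat) set" where
  "dwell_signals \<tau> =
     {\<sigma>. \<exists>d. signal_with \<sigma> d \<and> (\<forall>j\<ge>1. \<tau> \<le> stay1 d j \<and> \<tau> \<le> stay2 d j)}"

(* Cluster point of the subfamily of u indexed by G, as a sequence: repeated values count. *)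
definition cluster_point_along :: "nat set \<Rightarrow> (nat \<Rightarrow> 'a::topological_space) \<Rightarrow> 'a \<Rightarrow> bool" where
  "cluster_point_along G u p \<longleftrightarrow> (\<forall>U. open U \<and> p \<in> U \<longrightarrow> infinite {j \<in> G. u j \<in> U})"

definition dwell_signals' :: "real \<Rightarrow> (real \<Rightarrow> nat) set" where
  "dwell_signals' \<tau> =
     {\<sigma> \<in> dwell_signals \<tau>. \<exists>d. signal_with \<sigma> d \<and>
        (\<exists>\<Gamma>\<subseteq>{1..}. infinite \<Gamma> \<and>
           \<not> cluster_point_along \<Gamma> (\<lambda>j. (stay1 d j, stay2 d j)) (\<tau>, \<tau>))}"

(* Solutions are continuous, and differentiable away from the switching times,
   where in general only one-sided derivatives exist. *)
definition solution :: "(nat \<Rightarrow> real^2^2) \<Rightarrow> (real \<Rightarrow> nat) \<Rightarrow> (real \<Rightarrow> real^2) \<Rightarrow> bool" where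
  "solution A \<sigma> x \<longleftrightarrow>
     continuous_on {0..} x \<and>
     (\<forall>t>0. isCont \<sigma> t \<longrightarrow> (x has_vector_derivative (A (\<sigma> t) *v x t)) (at t))"

definition switched_stable :: "(nat \<Rightarrow> real^2^2) \<Rightarrow> (real \<Rightarrow> nat) \<Rightarrow> bool" where
  "switched_stable A \<sigma> \<longleftrightarrow>
     (\<forall>\<epsilon>>0. \<exists>\<delta>>0. \<forall>x. solution A \<sigma> x \<and> norm (x 0) < \<delta> \<longrightarrow> (\<forall>t>0. norm (x t) < \<epsilon>))"

definition asymptotically_stable :: "(nat \<Rightarrow> real^2^2) \<Rightarrow> (real \<Rightarrow> nat) \<Rightarrow> bool" where
  "asymptotically_stable A \<sigma> \<longleftrightarrow>
     switched_stable A \<sigma> \<and> (\<forall>x. solution A \<sigma> x \<longrightarrow> ((\<lambda>t. norm (x t)) \<longlongrightarrow> 0) at_top)"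

definition crit_eq :: "real \<Rightarrow> real \<Rightarrow> real \<Rightarrow> real \<Rightarrow> real \<Rightarrow> real \<Rightarrow> real \<Rightarrow> bool" where
  "crit_eq a c n1 p2 q2 t s \<longleftrightarrow>
     a * c * t * cosh ((q2 - p2) / 2 * s) =
       sinh ((q2 - p2) / 2 * s) + sgn (a * c) * sinh ((q2 + p2) / 2 * s + n1 * t)"

definition crit_pair :: "real \<Rightarrow> real \<Rightarrow> real \<Rightarrow> real \<Rightarrow> real \<Rightarrow> real \<times> real \<Rightarrow> bool" where
  "crit_pair a c n1 p2 q2 = (\<lambda>(t, s).
     0 < t \<and> 0 < s \<and> crit_eq a c n1 p2 q2 t s \<and>
     t = - ((q2 + p2) / (2 * n1)) * s
         + 1 / n1 * arcosh (\<bar>a * c\<bar> / n1 * cosh ((q2 - p2) / 2 * s)))"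

definition diag_root :: "real \<Rightarrow> real \<Rightarrow> real \<Rightarrow> real \<Rightarrow> real \<Rightarrow> real \<Rightarrow> real \<Rightarrow> bool" where
  "diag_root a c n1 p2 q2 t0 t \<longleftrightarrow>
     t0 < t \<and>
     a * c * t * cosh ((q2 - p2) / 2 * t) =
       sinh ((q2 - p2) / 2 * t) + sgn (a * c) * sinh (((q2 + p2) / 2 + n1) * t)"

definition tau21 :: "real \<Rightarrow> real \<Rightarrow> real \<Rightarrow> real \<Rightarrow> real \<Rightarrow> real" where
  "tau21 a c n1 p2 q2 =
     (if \<bar>a * c\<bar> \<le> n1 then 0
      else let (t0, s0) = (THE z. crit_pair a c n1 p2 q2 z) in
        if s0 \<le> t0 then s0 else (THE t. diag_root a c n1 p2 q2 t0 t))"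

end

theory Submission
  imports Defs
begin

text \<open>
  In the eigenbasis of \<open>A 2\<close> the flow of \<open>A 1\<close> is \<open>exp (- n * t)\<close> times a shear along \<open>(a, c)\<close>
  driven by the invariant coordinate \<open>a * v - c * u\<close>. A single norm is constructed which no
  loop with dwell times at least \<open>\<tau>\<close> expands. If \<open>\<bar>a * c\<bar> \<le> n\<close>, a weighted maximum norm is
  decreased by both flows. Otherwise both equations for the critical dwell time say where
  \<open>sinh (P * s + n * t) + sgn (a * c) * sinh (D * s) - \<bar>a * c\<bar> * t * cosh (D * s)\<close> vanishes,
  with \<open>P = (q + p) / 2\<close> and \<open>D = (q - p) / 2\<close>. This gap is convex in \<open>t\<close>, and divided by
  \<open>cosh (D * s)\<close> it increases in \<open>s\<close>, so it is nonnegative for \<open>s = \<tau>\<close> and all \<open>t \<ge> \<tau>\<close>.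
  That single inequality makes a norm adapted to the sign of \<open>a * c\<close> contract uniformly over
  all loops. Uniform contraction can fail only for \<open>\<tau> = 0\<close>, as both dwell times tend to \<open>0\<close>,
  and this is what the cluster point condition excludes.
\<close>

section \<open>The critical dwell time\<close>

text \<open>Strict convexity of \<open>sinh\<close> on the nonnegative half-line: a chord has slope
  \<open>cosh z\<close> for some \<open>z\<close> strictly between its endpoints, and
  \<open>cosh\<close> increases there.\<close>

lemma sinh_above_tangent:
  fixes x y :: real
  assumes "0 \<le> x" "0 \<le> y" "x \<noteq> y"
  shows "sinh x + cosh x * (y - x) < sinh y"
proof (cases "x < y")
  case True
  obtain z where z: "x < z" "z < y" "sinh y - sinh x = (y - x) * cosh z"
    using MVT2[OF True, of sinh cosh] by (auto simp: has_field_derivative_sinh[OF DERIV_ident, simplified])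
  have "cosh x * (y - x) < cosh z * (y - x)"
    using z assms True by (intro mult_strict_right_mono) (auto simp: cosh_real_nonneg_less_iff)
  then show ?thesis using z(3) by (simp add: mult.commute[of _ "y - x"])
next
  case False
  then have less: "y < x" using assms by simp
  obtain z where z: "y < z" "z < x" "sinh x - sinh y = (x - y) * cosh z"
    using MVT2[OF less, of sinh cosh] by (auto simp: has_field_derivative_sinh[OF DERIV_ident, simplified])
  have "cosh z * (x - y) < cosh x * (x - y)"
    using z assms less by (intro mult_strict_right_mono) (auto simp: cosh_real_nonneg_less_iff)
  then show ?thesis using z by (simp add: algebra_simps)
qed

text \<open>Both signs of \<open>a * c\<close> are treated at once: \<open>\<kappa>\<close> stands
  for its absolute value and \<open>e\<close> for its sign. The condition \<open>D < P\<close>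
  encodes \<open>0 < p\<close>, and \<open>n < \<kappa>\<close> is case (ii).\<close>

locale critical_curve =
  fixes n P D \<kappa> e :: real
  assumes n_pos: "0 < n" and D_pos: "0 < D" and D_less_P: "D < P"
    and n_less: "n < \<kappa>" and e_sign: "e = 1 \<or> e = -1"
begin

definition gap :: "real \<Rightarrow> real \<Rightarrow> real" where
  "gap t s = sinh (P * s + n * t) + e * sinh (D * s) - \<kappa> * t * cosh (D * s)"

text \<open>This is the partial derivative of \<open>gap\<close> in \<open>t\<close>. Solving
  \<open>slope t s = 0\<close> for \<open>t\<close> produces the second equation of the critical
  system.\<close>

definition slope :: "real \<Rightarrow> real \<Rightarrow> real" where
  "slope t s = n * cosh (P * s + n * t) - \<kappa> * cosh (D * s)"

text \<open>For fixed \<open>s\<close> the gap is strictly convex in \<open>t\<close>, so these are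
  the points where its minimum over nonnegative \<open>t\<close> equals 0.\<close>

definition tangency :: "real \<Rightarrow> real \<Rightarrow> bool" where
  "tangency t s \<longleftrightarrow> 0 < t \<and> 0 < s \<and> gap t s = 0 \<and> slope t s = 0"

lemma gap_above_tangent:
  assumes "0 \<le> s" "0 \<le> t" "0 \<le> u" "t \<noteq> u"
  shows "gap t s + slope t s * (u - t) < gap u s"
proof -
  have "sinh (P * s + n * t) + cosh (P * s + n * t) * ((P * s + n * u) - (P * s + n * t)) < sinh (P * s + n * u)"
    using assms n_pos D_pos D_less_P by (intro sinh_above_tangent) auto
  then show ?thesis by (simp add: gap_def slope_def algebra_simps)
qed

text \<open>The point is that \<open>gap t s / cosh (D * s)\<close> is strictly increasing in \<open>s\<close>.\<close>
lemma gap_pos_mono: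
  assumes "s1 < s2" "0 \<le> gap t s1"
  shows "0 < gap t s2"
proof -
  define E1 E2 d1 d2 h where defs: "E1 = P * s1 + n * t" "E2 = P * s2 + n * t" "d1 = D * s1" "d2 = D * s2"
    "h = d2 - d1"
  have h: "0 < h" using assms D_pos by (simp add: defs)
  have "D * (s2 - s1) < P * (s2 - s1)" using D_less_P assms by simp
  then have E2: "E1 + h < E2" by (simp add: defs algebra_simps)
  have d2: "d2 = d1 + h" by (simp add: defs)
  \<comment> \<open>In \<open>gap t s2 * cosh d1 - gap t s1 * cosh d2\<close> the terms with
    \<open>\<kappa>\<close> cancel. As \<open>D < P\<close> gives \<open>E1 + h < E2\<close>, the
    remainder exceeds \<open>sinh h * (cosh (E1 - d1) + e)\<close>, and \<open>cosh\<close> being at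
    least 1 absorbs \<open>e = -1\<close>.\<close>
  have "sinh (E1 + h) * cosh d1 - sinh E1 * cosh d2 = sinh h * cosh (E1 - d1)"
    by (simp add: d2 sinh_add cosh_add cosh_diff algebra_simps)
  moreover have "sinh h * 1 \<le> sinh h * cosh (E1 - d1)"
    using h by (intro mult_left_mono cosh_real_ge_1) simp
  moreover have "sinh (E1 + h) * cosh d1 < sinh E2 * cosh d1"
    using E2 by simp
  moreover have "sinh d2 * cosh d1 - sinh d1 * cosh d2 = sinh h"
    by (simp add: defs sinh_diff)
  moreover have "sinh h + e * sinh h \<ge> 0" using e_sign h by auto
  ultimately have "0 < sinh E2 * cosh d1 - sinh E1 * cosh d2 + e * (sinh d2 * cosh d1 - sinh d1 * cosh d2)"
    by (smt (verit))
  also have "\<dots> = gap t s2 * cosh d1 - gap t s1 * cosh d2"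
    by (simp add: gap_def defs(1-4) algebra_simps)
  finally have "0 < gap t s2 * cosh d1"
    using assms(2) by (smt (verit) cosh_real_nonneg mult_nonneg_nonneg)
  then show ?thesis by (rule zero_less_mult_pos2) simp
qed

lemma tangency_min:
  assumes "tangency t0 s0" "0 \<le> t" "t \<noteq> t0"
  shows "0 < gap t s0"
  using gap_above_tangent[of s0 t0 t] assms by (auto simp: tangency_def)

text \<open>For tangencies at heights \<open>s1 < s2\<close>, minimality at the lower one gives
  \<open>0 \<le> gap t2 s1\<close>, and monotonicity in \<open>s\<close> then makes
  \<open>gap t2 s2\<close> positive. At equal heights the strictness of the minimum decides.\<close>

lemma tangency_unique:
  assumes "tangency t1 s1" "tangency t2 s2"
  shows "t1 = t2 \<and> s1 = s2"
proof -
  have *: False if "tangency t1 s1" "tangency t2 s2" "s1 < s2" for t1 s1 t2 s2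
  proof -
    have "0 \<le> gap t2 s1"
      using tangency_min[OF that(1), of t2] that by (cases "t1 = t2") (auto simp: tangency_def)
    then have "0 < gap t2 s2" by (rule gap_pos_mono[OF that(3)])
    then show False using that(2) by (simp add: tangency_def)
  qed
  have "s1 = s2" using *[OF assms] *[OF assms(2,1)] by (meson linorder_neqE_linordered_idom)
  moreover have "t1 = t2"
    using tangency_min[OF assms(1), of t2] assms(2) \<open>s1 = s2\<close>
    unfolding tangency_def by force
  ultimately show ?thesis by simp
qed

section \<open>Minimizers in \<open>t\<close> and existence of a tangency\<close>

definition tstar :: "real \<Rightarrow> real" where
  "tstar s = (arcosh (\<kappa> / n * cosh (D * s)) - P * s) / n"

lemma ratio_ge: "cosh (D * s) < \<kappa> / n * cosh (D * s)"
  using n_pos n_less by (simp add: field_simps)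

lemma ratio_gt_1: "1 < \<kappa> / n * cosh (D * s)"
  using ratio_ge[of s] cosh_real_ge_1[of "D * s"] by linarith

lemma tstar_energy: "P * s + n * tstar s = arcosh (\<kappa> / n * cosh (D * s))"
  using n_pos by (simp add: tstar_def)

lemma slope_tstar: "slope (tstar s) s = 0"
  unfolding slope_def tstar_energy using ratio_gt_1[of s] n_pos by simp

lemma energy_tstar:
  assumes "0 \<le> s" shows "D * s < P * s + n * tstar s"
proof -
  have "arcosh (cosh (D * s)) < P * s + n * tstar s"
    unfolding tstar_energy by (rule arcosh_real_strict_mono[OF cosh_real_ge_1 ratio_ge])
  then show ?thesis using assms D_pos by (simp add: arcosh_cosh_real)
qed

text \<open>At a nonpositive minimizer the linear term of the gap is nonnegative, and the
  \<open>sinh\<close> with the larger argument dominates the other one. Hence a zero of the gap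
  along \<open>tstar\<close> can only occur at positive \<open>t\<close>.\<close>

lemma gap_pos_if_tstar_nonpos:
  assumes "0 \<le> s" "tstar s \<le> 0"
  shows "0 < gap (tstar s) s"
proof -
  have "0 \<le> sinh (D * s)" using assms D_pos by simp
  moreover have "sinh (D * s) < sinh (P * s + n * tstar s)"
    using energy_tstar[OF assms(1)] by simp
  ultimately have "0 < sinh (P * s + n * tstar s) + e * sinh (D * s)"
    using e_sign by (elim disjE) (hypsubst, linarith)+
  moreover have "\<kappa> * tstar s * cosh (D * s) \<le> 0"
    using assms n_pos n_less by (intro mult_nonpos_nonneg mult_nonneg_nonpos) auto
  ultimately show ?thesis by (simp add: gap_def)
qed

lemma tstar_eventually_neg: "\<exists>s>0. tstar s < 0"
proof -
  \<comment> \<open>Since \<open>arcosh x \<le> ln (2 * x)\<close>, the \<open>arcosh\<close> in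
    \<open>tstar s\<close> is at most \<open>ln (2 * (\<kappa> / n)) + D * s\<close>. This
    \<open>s\<close> makes \<open>(P - D) * s\<close> exceed the logarithm by 1.\<close>
  define s where "s = (ln (2 * (\<kappa> / n)) + 1) / (P - D)"
  have L: "0 < ln (2 * (\<kappa> / n))" using n_pos n_less by (intro ln_gt_zero) (simp add: field_simps)
  then have s: "0 < s" using D_less_P by (simp add: s_def)
  let ?x = "\<kappa> / n * cosh (D * s)"
  have x: "1 < ?x" by (rule ratio_gt_1)
  have "sqrt (?x\<^sup>2 - 1) \<le> sqrt (?x\<^sup>2)" by (intro real_sqrt_le_mono) simp
  also have "\<dots> = ?x" by (simp only: real_sqrt_abs abs_of_pos less_trans[OF zero_less_one x])
  finally have "arcosh ?x \<le> ln (2 * ?x)"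
    using x by (subst arcosh_real_def) (auto intro!: ln_mono add_pos_nonneg)
  also have "\<dots> \<le> ln (2 * (\<kappa> / n) * exp (D * s))"
  proof (rule ln_mono)
    have "cosh (D * s) \<le> exp (D * s)"
      using s D_pos by (subst cosh_plus_sinh[symmetric]) simp
    then have "?x \<le> \<kappa> / n * exp (D * s)"
      using n_pos n_less by (intro mult_left_mono) auto
    then show "2 * ?x \<le> 2 * (\<kappa> / n) * exp (D * s)" by simp
  qed (use x in auto)
  also have "\<dots> = ln (2 * (\<kappa> / n)) + D * s"
    using n_pos n_less by (subst ln_mult) auto
  also have "\<dots> < P * s"
  proof -
    have "s * (P - D) = ln (2 * (\<kappa> / n)) + 1" using D_less_P by (simp add: s_def)
    then show ?thesis by (simp add: algebra_simps)
  qed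
  finally show ?thesis using s n_pos by (auto simp: tstar_def divide_neg_pos)
qed

lemma sinh_less_mult_cosh:
  assumes "0 < x" shows "sinh x < x * cosh (x::real)"
  using sinh_above_tangent[of x 0] assms by (simp add: mult.commute)

text \<open>Intermediate values along the curve of minimizers. At \<open>s = 0\<close> the minimum
  is negative, because \<open>sinh x < x * cosh x\<close> and the vanishing slope replaces
  \<open>n * cosh (n * tstar 0)\<close> by \<open>\<kappa>\<close>. Far out the minimizer is
  negative and the gap positive.\<close>

lemma tangency_exists: "\<exists>t s. tangency t s"
proof -
  obtain b where b: "0 < b" "tstar b < 0" using tstar_eventually_neg by blast
  have gb: "0 < gap (tstar b) b" using b by (intro gap_pos_if_tstar_nonpos) auto
  have "0 < n * tstar 0" using energy_tstar[of 0] by simp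
  then have "sinh (n * tstar 0) < n * tstar 0 * cosh (n * tstar 0)"
    by (rule sinh_less_mult_cosh)
  also have "\<dots> = \<kappa> * tstar 0" using slope_tstar[of 0] by (simp add: slope_def algebra_simps)
  finally have g0: "gap (tstar 0) 0 < 0" by (simp add: gap_def)
  have cont: "continuous_on {0..b} (\<lambda>s. gap (tstar s) s)"
    unfolding gap_def tstar_def using ratio_gt_1 n_pos
    by (intro continuous_intros) (auto intro: less_imp_le)
  obtain s where s: "0 \<le> s" "s \<le> b" "gap (tstar s) s = 0"
    using IVT'[of "\<lambda>s. gap (tstar s) s" 0 0 b] cont g0 gb b by force
  have "s \<noteq> 0" using g0 s by auto
  moreover have "0 < tstar s" using gap_pos_if_tstar_nonpos[of s] s by force
  ultimately have "tangency (tstar s) s" using s slope_tstar by (simp add: tangency_def)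
  then show ?thesis by blast
qed

text \<open>On the nonnegative half-line, where \<open>P * s + n * t\<close> lies,
  \<open>arcosh\<close> inverts \<open>cosh\<close>, so the slope condition can be solved for
  \<open>t\<close>. This matches tangencies with the form used in \<open>crit_pair\<close>.\<close>

lemma tangency_iff_tstar:
  "tangency t s \<longleftrightarrow> 0 < t \<and> 0 < s \<and> gap t s = 0 \<and> t = tstar s"
proof -
  have "t = tstar s" if "0 < t" "0 < s" "slope t s = 0"
  proof -
    have "cosh (P * s + n * t) = \<kappa> / n * cosh (D * s)"
      using that n_pos by (simp add: slope_def field_simps)
    moreover have "0 \<le> P * s + n * t" using that n_pos D_pos D_less_P by simp
    ultimately have "P * s + n * t = P * s + n * tstar s"
      unfolding tstar_energy by (metis arcosh_cosh_real)
    then show ?thesis using n_pos by simp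
  qed
  then show ?thesis using slope_tstar by (auto simp: tangency_def)
qed

section \<open>The diagonal root in the case \<open>t0 < s0\<close>\<close>

lemma diagonal_root_less:
  assumes "tangency t0 s0" "0 \<le> t" "t0 < s0" "gap t t = 0"
  shows "t < s0"
proof (rule ccontr)
  assume "\<not> t < s0"
  have "0 < gap t s0" using tangency_min[OF assms(1,2)] \<open>\<not> t < s0\<close> assms(3) by simp
  then have "0 < gap t t"
    using gap_pos_mono[of s0 t t] \<open>\<not> t < s0\<close> by (cases "t = s0") auto
  then show False using assms(4) by simp
qed

text \<open>At height \<open>t1\<close>, which lies below \<open>s0\<close>, the gap is negative at
  \<open>t0\<close> by monotonicity in \<open>s\<close> and zero at \<open>t1\<close>. A convex
  function that rises from \<open>t0\<close> to \<open>t1\<close> stays positive beyond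
  \<open>t1\<close>.\<close>

lemma gap_pos_beyond_diagonal_root:
  assumes "tangency t0 s0" "t0 < s0" "t0 < t1" "gap t1 t1 = 0" "t1 < u"
  shows "0 < gap u t1"
proof -
  have "0 < t0" using assms(1) by (simp add: tangency_def)
  then have "t1 < s0" using diagonal_root_less[OF assms(1) _ assms(2,4)] assms(3) by simp
  then have "gap t0 t1 < 0"
    using gap_pos_mono[of t1 s0 t0] assms(1) by (force simp: tangency_def)
  moreover have "gap t1 t1 + slope t1 t1 * (t0 - t1) < gap t0 t1"
    using assms \<open>0 < t0\<close> by (intro gap_above_tangent) auto
  ultimately have "slope t1 t1 * (t0 - t1) < 0" using assms(4) by linarith
  then have "0 < slope t1 t1" using assms(3) by (simp add: mult_less_0_iff)
  then have "0 < slope t1 t1 * (u - t1)" using assms(5) by simp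
  moreover have "gap t1 t1 + slope t1 t1 * (u - t1) < gap u t1"
    using assms \<open>0 < t0\<close> by (intro gap_above_tangent) auto
  ultimately show ?thesis using assms(4) by linarith
qed

text \<open>On the diagonal the gap is negative at \<open>t0\<close> (below the tangency) and
  positive at \<open>s0\<close> (away from the minimizer). Given roots \<open>t1 < t2\<close>,
  already \<open>gap t2 t1\<close> is positive, and raising the height to \<open>t2\<close> keeps it
  so.\<close>

lemma diagonal_root_ex1:
  assumes "tangency t0 s0" "t0 < s0"
  shows "\<exists>!t. t0 < t \<and> gap t t = 0"
proof -
  have "gap t0 t0 < 0"
    using gap_pos_mono[of t0 s0 t0] assms by (force simp: tangency_def)
  moreover have "0 < gap s0 s0"
    using tangency_min[OF assms(1), of s0] assms by (auto simp: tangency_def)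
  moreover have "continuous_on {t0..s0} (\<lambda>t. gap t t)"
    unfolding gap_def by (intro continuous_intros)
  ultimately obtain t where t: "t0 \<le> t" "gap t t = 0"
    using IVT'[of "\<lambda>t. gap t t" t0 0 s0] assms(2) by force
  then have "t0 < t" using \<open>gap t0 t0 < 0\<close> by (cases "t = t0") auto
  moreover have False if "t0 < t1" "gap t1 t1 = 0" "t1 < t2" "gap t2 t2 = 0" for t1 t2
    using gap_pos_mono[of t1 t2 t2] gap_pos_beyond_diagonal_root[OF assms that(1-3)] that by simp
  ultimately show ?thesis using t(2) by (metis linorder_neqE_linordered_idom)
qed

end

section \<open>The equations defining \<open>tau21\<close> in terms of the gap\<close>

lemma critical_curve_instance:
  fixes a c n p q :: real
  assumes "0 < n" "0 < p" "p < q" "n < \<bar>a * c\<bar>"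
  shows "critical_curve n ((q + p) / 2) ((q - p) / 2) \<bar>a * c\<bar> (sgn (a * c))"
  using assms by unfold_locales (auto simp: sgn_if)

context
  fixes a c n p q :: real
  assumes pos: "0 < n" "0 < p" "p < q" "n < \<bar>a * c\<bar>"
begin

interpretation critical_curve n "(q + p) / 2" "(q - p) / 2" "\<bar>a * c\<bar>" "sgn (a * c)"
  using critical_curve_instance[OF pos] .

text \<open>Multiplying the equation by \<open>sgn (a * c)\<close> turns \<open>a * c\<close> into
  its absolute value and moves the sign to the other \<open>sinh\<close>.\<close>

lemma crit_eq_iff_gap: "crit_eq a c n p q t s \<longleftrightarrow> gap t s = 0"
proof (cases "0 < a * c")
  case True
  then show ?thesis unfolding crit_eq_def gap_def by (auto simp add: algebra_simps)
next
  case False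
  then have "a * c < 0" using pos by auto
  then show ?thesis unfolding crit_eq_def gap_def by (auto simp add: abs_if algebra_simps)
qed

lemma diag_root_iff_gap: "diag_root a c n p q t0 t \<longleftrightarrow> t0 < t \<and> gap t t = 0"
proof -
  have "((q + p) / 2 + n) * t = (q + p) / 2 * t + n * t" by (rule distrib_right)
  then show ?thesis by (simp only: crit_eq_iff_gap[symmetric] diag_root_def crit_eq_def)
qed

lemma crit_pair_iff_tangency: "crit_pair a c n p q (t, s) \<longleftrightarrow> tangency t s"
proof -
  have "- ((q + p) / (2 * n)) * s + 1 / n * arcosh (\<bar>a * c\<bar> / n * cosh ((q - p) / 2 * s)) = tstar s"
    unfolding tstar_def using pos by (simp add: field_simps)
  then show ?thesis by (simp add: crit_pair_def crit_eq_iff_gap tangency_iff_tstar)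
qed

lemma crit_pair_ex1: "\<exists>!z. crit_pair a c n p q z"
proof -
  obtain t s where ts: "tangency t s" using tangency_exists by blast
  show ?thesis
  proof (rule ex1I)
    show "crit_pair a c n p q (t, s)" unfolding crit_pair_iff_tangency by (rule ts)
    fix z assume z: "crit_pair a c n p q z"
    obtain t' s' where eq: "z = (t', s')" by (cases z)
    have "tangency t' s'" using z unfolding eq crit_pair_iff_tangency .
    from tangency_unique[OF this ts] show "z = (t, s)" unfolding eq by blast
  qed
qed

lemma diag_root_ex1:
  assumes "crit_pair a c n p q (t0, s0)" "t0 < s0"
  shows "\<exists>!t. diag_root a c n p q t0 t"
  unfolding diag_root_iff_gap
  using assms by (intro diagonal_root_ex1) (simp_all only: crit_pair_iff_tangency)

text \<open>In case (a) the height is \<open>s0\<close>, where the minimum of the gap is 0. In case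
  (b) it is the diagonal root, and \<open>\<tau> \<le> t\<close> puts \<open>t\<close> on the side
  where the gap is nonnegative. The norms below use only these two facts about
  \<open>\<tau>\<close>.\<close>

lemma tau21_bound:
  defines "\<tau> \<equiv> tau21 a c n p q"
  shows "0 < \<tau>"
    and "\<tau> \<le> t \<Longrightarrow> \<bar>a * c\<bar> * t * cosh ((q - p) / 2 * \<tau>)
      \<le> sinh ((q + p) / 2 * \<tau> + n * t) + sgn (a * c) * sinh ((q - p) / 2 * \<tau>)"
proof -
  obtain z where z: "crit_pair a c n p q z" using ex1_implies_ex[OF crit_pair_ex1] ..
  obtain t0 s0 where "z = (t0, s0)" by (cases z)
  with z have ts: "crit_pair a c n p q (t0, s0)" by simp
  then have the: "(THE z. crit_pair a c n p q z) = (t0, s0)"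
    by (rule the1_equality[OF crit_pair_ex1])
  have tan: "tangency t0 s0" using ts by (simp add: crit_pair_iff_tangency)
  have "0 < \<tau> \<and> (\<forall>t\<ge>\<tau>. 0 \<le> gap t \<tau>)"
  proof (cases "s0 \<le> t0")
    case True
    then have "\<tau> = s0" using pos by (simp add: \<tau>_def tau21_def the)
    moreover have "0 \<le> gap t s0" if "s0 \<le> t" for t
      using tangency_min[OF tan, of t] tan that by (cases "t = t0") (auto simp: tangency_def)
    ultimately show ?thesis using tan by (simp add: tangency_def)
  next
    case False
    then have "\<tau> = (THE t. diag_root a c n p q t0 t)" using pos by (simp add: \<tau>_def tau21_def the)
    then have "diag_root a c n p q t0 \<tau>"
      using theI'[OF diag_root_ex1[OF ts]] False by simp
    then have r: "t0 < \<tau>" "gap \<tau> \<tau> = 0" by (auto simp: diag_root_iff_gap)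
    moreover have "0 \<le> gap t \<tau>" if "\<tau> \<le> t" for t
      using gap_pos_beyond_diagonal_root[OF tan _ r, of t] False that r(2) by (cases "t = \<tau>") auto
    ultimately show ?thesis using tan by (auto simp: tangency_def)
  qed
  then show "0 < \<tau>" and "\<tau> \<le> t \<Longrightarrow> \<bar>a * c\<bar> * t * cosh ((q - p) / 2 * \<tau>)
      \<le> sinh ((q + p) / 2 * \<tau> + n * t) + sgn (a * c) * sinh ((q - p) / 2 * \<tau>)"
    by (auto simp: gap_def)
qed

end

section \<open>Norms contracted by every loop\<close>

text \<open>These are the flows of \<open>A 1\<close> and \<open>A 2\<close> in the eigenbasis of \<open>A 2\<close>.\<close>

definition shear_flow :: "real \<Rightarrow> real \<Rightarrow> real \<Rightarrow> real \<Rightarrow> real \<times> real \<Rightarrow> real \<times> real" where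
  "shear_flow n a c t = (\<lambda>(u, v).
     (exp (- n * t) * (u + t * (a * v - c * u) * a), exp (- n * t) * (v + t * (a * v - c * u) * c)))"

definition diag_flow :: "real \<Rightarrow> real \<Rightarrow> real \<Rightarrow> real \<times> real \<Rightarrow> real \<times> real" where
  "diag_flow p q s = (\<lambda>(u, v). (exp (- p * s) * u, exp (- q * s) * v))"

text \<open>The bound \<open>B\<close> limits growth inside a loop, since the shear alone may expand
  \<open>V\<close>. The factor \<open>\<rho>\<close> may depend on \<open>\<eta>\<close>: for
  \<open>\<tau> = 0\<close> loops with both dwell times near 0 are near the identity and admit no
  uniform factor.\<close>

definition loop_contracting ::
  "real \<Rightarrow> real \<Rightarrow> real \<Rightarrow> real \<Rightarrow> real \<Rightarrow> real \<Rightarrow> (real \<times> real \<Rightarrow> real) \<Rightarrow> bool" where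
  "loop_contracting n p q a c \<tau> V \<longleftrightarrow>
     (\<exists>k>0. \<forall>u v. k * (\<bar>u\<bar> + \<bar>v\<bar>) \<le> V (u, v)) \<and>
     (\<exists>K>0. \<forall>u v. V (u, v) \<le> K * (\<bar>u\<bar> + \<bar>v\<bar>)) \<and>
     (\<exists>B>0. \<forall>t\<ge>0. \<forall>y. V (shear_flow n a c t y) \<le> B * V y) \<and>
     (\<forall>s\<ge>0. \<forall>y. V (diag_flow p q s y) \<le> V y) \<and>
     (\<forall>t s y. 0 < t \<and> 0 < s \<and> \<tau> \<le> t \<and> \<tau> \<le> s \<longrightarrow>
        V (diag_flow p q s (shear_flow n a c t y)) \<le> V y) \<and>
     (\<forall>\<eta>>0. \<exists>\<rho>. 0 \<le> \<rho> \<and> \<rho> < 1 \<and>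
        (\<forall>t s y. 0 < t \<and> 0 < s \<and> \<tau> \<le> t \<and> \<tau> \<le> s \<and> (\<tau> + \<eta> \<le> t \<or> \<tau> + \<eta> \<le> s) \<longrightarrow>
          V (diag_flow p q s (shear_flow n a c t y)) \<le> \<rho> * V y))"

lemma loop_contractingI:
  fixes V :: "real \<times> real \<Rightarrow> real"
  assumes "0 < k" "\<And>u v. k * (\<bar>u\<bar> + \<bar>v\<bar>) \<le> V (u, v)"
    and "0 < K" "\<And>u v. V (u, v) \<le> K * (\<bar>u\<bar> + \<bar>v\<bar>)"
    and "0 < B" "\<And>t y. 0 \<le> t \<Longrightarrow> V (shear_flow n a c t y) \<le> B * V y"
    and "\<And>s y. 0 \<le> s \<Longrightarrow> V (diag_flow p q s y) \<le> V y"
    and "\<And>t s y. 0 < t \<Longrightarrow> 0 < s \<Longrightarrow> \<tau> \<le> t \<Longrightarrow> \<tau> \<le> s \<Longrightarrow>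
        V (diag_flow p q s (shear_flow n a c t y)) \<le> V y"
    and "\<And>\<eta>. 0 < \<eta> \<Longrightarrow> \<exists>\<rho>. 0 \<le> \<rho> \<and> \<rho> < 1 \<and>
        (\<forall>t s y. 0 < t \<and> 0 < s \<and> \<tau> \<le> t \<and> \<tau> \<le> s \<and> (\<tau> + \<eta> \<le> t \<or> \<tau> + \<eta> \<le> s) \<longrightarrow>
          V (diag_flow p q s (shear_flow n a c t y)) \<le> \<rho> * V y)"
  shows "loop_contracting n p q a c \<tau> V"
  unfolding loop_contracting_def
proof (intro conjI)
  show "\<exists>k>0. \<forall>u v. k * (\<bar>u\<bar> + \<bar>v\<bar>) \<le> V (u, v)" using assms(1,2) by blast
  show "\<exists>K>0. \<forall>u v. V (u, v) \<le> K * (\<bar>u\<bar> + \<bar>v\<bar>)" using assms(3,4) by blast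
  show "\<exists>B>0. \<forall>t\<ge>0. \<forall>y. V (shear_flow n a c t y) \<le> B * V y" using assms(5,6) by blast
qed (use assms(7-) in blast)+

text \<open>For positive \<open>\<tau>\<close> one factor below 1 will serve all loops, which yields
  both loop conditions at once.\<close>

lemma loop_contracting_uniformI:
  fixes V :: "real \<times> real \<Rightarrow> real"
  assumes "0 < k" "\<And>u v. k * (\<bar>u\<bar> + \<bar>v\<bar>) \<le> V (u, v)"
    and "0 < K" "\<And>u v. V (u, v) \<le> K * (\<bar>u\<bar> + \<bar>v\<bar>)"
    and "0 < B" "\<And>t y. 0 \<le> t \<Longrightarrow> V (shear_flow n a c t y) \<le> B * V y"
    and "\<And>s y. 0 \<le> s \<Longrightarrow> V (diag_flow p q s y) \<le> V y"
    and "0 \<le> \<rho>" "\<rho> < 1"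
    and loop: "\<And>t s y. 0 < t \<Longrightarrow> 0 < s \<Longrightarrow> \<tau> \<le> t \<Longrightarrow> \<tau> \<le> s \<Longrightarrow>
        V (diag_flow p q s (shear_flow n a c t y)) \<le> \<rho> * V y"
  shows "loop_contracting n p q a c \<tau> V"
proof (rule loop_contractingI[OF assms(1-7)])
  fix t s :: real and y :: "real \<times> real" assume ts: "0 < t" "0 < s" "\<tau> \<le> t" "\<tau> \<le> s"
  obtain u v where y: "y = (u, v)" by (cases y)
  have "0 \<le> k * (\<bar>u\<bar> + \<bar>v\<bar>)" using assms(1) by simp
  also have "\<dots> \<le> V y" unfolding y by (rule assms(2))
  finally have "\<rho> * V y \<le> 1 * V y" using assms(9) by (intro mult_right_mono) auto
  then show "V (diag_flow p q s (shear_flow n a c t y)) \<le> V y" using loop[OF ts, of y] by simp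
next
  show "\<exists>\<rho>. 0 \<le> \<rho> \<and> \<rho> < 1 \<and>
        (\<forall>t s y. 0 < t \<and> 0 < s \<and> \<tau> \<le> t \<and> \<tau> \<le> s \<and> (\<tau> + \<eta> \<le> t \<or> \<tau> + \<eta> \<le> s) \<longrightarrow>
          V (diag_flow p q s (shear_flow n a c t y)) \<le> \<rho> * V y)" for \<eta>
    using assms(8,9) loop by blast
qed

section \<open>Linear growth against exponential decay\<close>

lemma one_plus_mult_exp_le:
  fixes n t \<kappa> :: real
  assumes "0 < n" "0 \<le> \<kappa>" "0 \<le> t"
  shows "(1 + \<kappa> * t) * exp (- n * t) \<le> 1 + \<kappa> / n"
proof -
  have "1 + \<kappa> * t \<le> (1 + \<kappa> / n) * (1 + n * t)" using assms by (simp add: field_simps)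
  also have "\<dots> \<le> (1 + \<kappa> / n) * exp (n * t)"
    using assms exp_ge_add_one_self[of "n * t"] by (intro mult_left_mono) auto
  finally show ?thesis by (simp add: exp_minus field_simps)
qed

lemma one_plus_mult_exp_antimono:
  fixes x y :: real
  assumes "0 \<le> x" "x \<le> y"
  shows "(1 + y) * exp (- y) \<le> (1 + x) * exp (- x)"
proof -
  have "0 \<le> x * (y - x)" using assms by simp
  then have "1 + y \<le> (1 + x) * (1 + (y - x))" by (simp add: algebra_simps)
  also have "\<dots> \<le> (1 + x) * exp (y - x)"
    using assms exp_ge_add_one_self[of "y - x"] by (intro mult_left_mono) auto
  finally have "(1 + y) * exp (- y) \<le> (1 + x) * exp (y - x) * exp (- y)"
    by (rule mult_right_mono) simp
  also have "\<dots> = (1 + x) * exp (- x)" by (simp add: exp_add[symmetric])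
  finally show ?thesis .
qed

lemma one_plus_mult_exp_less_1:
  fixes x :: real
  assumes "0 < x"
  shows "(1 + x) * exp (- x) < 1"
proof -
  have "0 < x\<^sup>2 / 2" using assms by simp
  then have "1 + x < exp x" using exp_lower_Taylor_quadratic[of x] assms by linarith
  then show ?thesis by (simp add: exp_minus field_simps)
qed

lemma weighted_max_norm_loop_contracting:
  fixes a c n p q :: real
  assumes "0 < n" "0 < p" "p < q" "\<bar>a * c\<bar> \<le> n"
  shows "\<exists>V. loop_contracting n p q a c 0 V"
proof -
  \<comment> \<open>The weights only have to satisfy \<open>\<alpha>1\<close>, \<open>\<alpha>2\<close> and \<open>\<beta>1\<close> below;
    \<open>\<alpha>\<close> exists precisely because \<open>\<bar>a * c\<bar> \<le> n\<close>.\<close>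
  define \<alpha> where "\<alpha> = (if a = 0 then 1 + \<bar>c\<bar> else n / \<bar>a\<bar>)"
  define \<beta> where "\<beta> = n / (1 + \<bar>c\<bar>)"
  define V :: "real \<times> real \<Rightarrow> real" where
    "V = (\<lambda>(u, v). max (max (\<alpha> * \<bar>u\<bar>) (\<beta> * \<bar>v\<bar>)) \<bar>a * v - c * u\<bar>)"
  have pos: "0 < \<alpha>" "0 < \<beta>" using assms by (auto simp: \<alpha>_def \<beta>_def add_pos_nonneg)
  have \<alpha>1: "\<bar>c\<bar> \<le> \<alpha>" using assms by (auto simp: \<alpha>_def field_simps abs_mult)
  have \<alpha>2: "\<alpha> * \<bar>a\<bar> \<le> n" using assms by (auto simp: \<alpha>_def)
  have \<beta>1: "\<beta> * \<bar>c\<bar> \<le> n" using assms by (auto simp: \<beta>_def field_simps)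
  have Vge: "\<alpha> * \<bar>u\<bar> \<le> V (u, v)" "\<beta> * \<bar>v\<bar> \<le> V (u, v)" "\<bar>a * v - c * u\<bar> \<le> V (u, v)" for u v
    by (auto simp: V_def)
  have Vle: "V (u, v) \<le> M"
    if "\<alpha> * \<bar>u\<bar> \<le> M" "\<beta> * \<bar>v\<bar> \<le> M" "\<bar>a * v - c * u\<bar> \<le> M" for u v M
    using that by (auto simp: V_def)
  have V0: "0 \<le> V y" for y by (cases y) (auto simp: V_def)
  have shear: "V (shear_flow n a c t y) \<le> (1 + n * t) * exp (- n * t) * V y" if "0 \<le> t" for t y
  proof -
    obtain u v where y: "y = (u, v)" by (cases y)
    let ?z = "a * v - c * u" and ?E = "exp (- n * t)"
    \<comment> \<open>The shear adds \<open>t * ?z * b\<close> to a coordinate of weight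
      \<open>w\<close>. Because \<open>w * \<bar>b\<bar> \<le> n\<close>, the norm grows at most by
      \<open>1 + n * t\<close>, which the factor \<open>?E\<close> compensates.\<close>
    have *: "w * \<bar>x + t * ?z * b\<bar> \<le> (1 + n * t) * V y"
      if "0 \<le> w" "w * \<bar>x\<bar> \<le> V y" "w * \<bar>b\<bar> \<le> n" for w x b
    proof -
      have "\<bar>x + t * ?z * b\<bar> \<le> \<bar>x\<bar> + t * \<bar>?z\<bar> * \<bar>b\<bar>"
        using \<open>0 \<le> t\<close> abs_triangle_ineq[of x "t * ?z * b"] by (simp add: abs_mult)
      then have "w * \<bar>x + t * ?z * b\<bar> \<le> w * (\<bar>x\<bar> + t * \<bar>?z\<bar> * \<bar>b\<bar>)"
        using that(1) by (rule mult_left_mono)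
      also have "\<dots> = w * \<bar>x\<bar> + t * (\<bar>?z\<bar> * (w * \<bar>b\<bar>))" by (simp add: algebra_simps)
      also have "\<dots> \<le> V y + t * (V y * n)"
        using that(1,2,3) \<open>0 \<le> t\<close> Vge(3)[of v u] V0[of y]
        by (intro add_mono mult_left_mono mult_mono) (auto simp: y)
      finally show ?thesis by (simp add: algebra_simps)
    qed
    have s1: "w * \<bar>?E * x\<bar> \<le> (1 + n * t) * ?E * V y" if "w * \<bar>x\<bar> \<le> (1 + n * t) * V y" for w x
      using mult_left_mono[OF that, of ?E] by (simp add: abs_mult mult_ac)
    have "\<bar>?z\<bar> \<le> (1 + n * t) * V y"
      using Vge(3)[of v u] V0[of y] \<open>0 \<le> t\<close> assms(1) by (simp add: y algebra_simps add_increasing2)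
    moreover have "a * (?E * (v + t * ?z * c)) - c * (?E * (u + t * ?z * a)) = ?E * ?z"
      by (simp add: algebra_simps)
    ultimately show ?thesis unfolding y shear_flow_def prod.case
      using s1[OF *[of \<alpha> u a]] s1[OF *[of \<beta> v c]] s1[of 1 ?z] pos \<alpha>2 \<beta>1 Vge(1)[of u v] Vge(2)[of v u]
      by (intro Vle) (auto simp: y)
  qed
  have diag: "V (diag_flow p q s y) \<le> exp (- p * s) * V y" if "0 \<le> s" for s y
  proof -
    obtain u v where y: "y = (u, v)" by (cases y)
    define \<theta> where "\<theta> = exp (- (q - p) * s)"
    have \<theta>: "0 < \<theta>" "\<theta> \<le> 1" using that assms by (auto simp: \<theta>_def mult_nonpos_nonneg)
    have q: "exp (- q * s) = exp (- p * s) * \<theta>" by (simp add: \<theta>_def exp_add[symmetric] algebra_simps)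
    let ?E = "exp (- p * s)" and ?z = "a * v - c * u"
    \<comment> \<open>Up to \<open>?E\<close>, the diagonal flow sends the third functional to a
      convex combination of \<open>?z\<close> and \<open>- c * u\<close>. The weight condition
      \<alpha>1 bounds the latter by the norm as well.\<close>
    have "\<bar>\<theta> * ?z - (1 - \<theta>) * (c * u)\<bar> \<le> \<theta> * \<bar>?z\<bar> + (1 - \<theta>) * (\<bar>c\<bar> * \<bar>u\<bar>)"
      using \<theta> abs_triangle_ineq4[of "\<theta> * ?z" "(1 - \<theta>) * (c * u)"] by (simp add: abs_mult)
    also have "\<dots> \<le> \<theta> * V y + (1 - \<theta>) * V y"
    proof (intro add_mono mult_left_mono)
      show "\<bar>c\<bar> * \<bar>u\<bar> \<le> V y"
        using mult_right_mono[OF \<alpha>1, of "\<bar>u\<bar>"] Vge(1)[of u v] by (simp add: y)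
    qed (use \<theta> Vge[of v u] y in auto)
    finally have z: "\<bar>\<theta> * ?z - (1 - \<theta>) * (c * u)\<bar> \<le> V y" by (simp add: algebra_simps)
    have "\<beta> * \<bar>\<theta> * v\<bar> = \<theta> * (\<beta> * \<bar>v\<bar>)" using \<theta> by (simp add: abs_mult)
    also have "\<dots> \<le> 1 * (\<beta> * \<bar>v\<bar>)" using \<theta> pos by (intro mult_right_mono) auto
    also have "\<dots> \<le> V y" using Vge(2)[of v u] by (simp add: y)
    finally have v: "\<beta> * \<bar>\<theta> * v\<bar> \<le> V y" .
    have s1: "w * \<bar>?E * x\<bar> \<le> ?E * V y" if "w * \<bar>x\<bar> \<le> V y" for w x
      using mult_left_mono[OF that, of ?E] by (simp add: abs_mult mult_ac)
    have "a * (?E * \<theta> * v) - c * (?E * u) = ?E * (\<theta> * ?z - (1 - \<theta>) * (c * u))"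
      by (simp add: algebra_simps)
    then show ?thesis unfolding y diag_flow_def prod.case q
      using s1[OF Vge(1)[of u v, folded y]] s1[OF v] s1[of 1, simplified, OF z]
      by (intro Vle) (auto simp: y mult.assoc)
  qed
  have loop: "V (diag_flow p q s (shear_flow n a c t y))
      \<le> exp (- p * s) * ((1 + n * t) * exp (- n * t)) * V y" if "0 \<le> t" "0 \<le> s" for t s y
    using order_trans[OF diag[OF that(2)] mult_left_mono[OF shear[OF that(1)]]]
    by (simp add: mult.assoc)
  have f1: "(1 + n * t) * exp (- n * t) \<le> 1" if "0 \<le> t" for t
    using one_plus_mult_exp_antimono[of 0 "n * t"] that assms by simp
  show ?thesis
  proof (rule exI, rule loop_contractingI)
    show "0 < min \<alpha> \<beta> / 2" using pos by simp
    show "min \<alpha> \<beta> / 2 * (\<bar>u\<bar> + \<bar>v\<bar>) \<le> V (u, v)" for u v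
      using Vge(1)[of u v] Vge(2)[of v u] mult_right_mono[of "min \<alpha> \<beta>" \<alpha> "\<bar>u\<bar>"]
        mult_right_mono[of "min \<alpha> \<beta>" \<beta> "\<bar>v\<bar>"] by (simp add: distrib_left)
    show "0 < \<alpha> + \<beta> + \<bar>a\<bar> + \<bar>c\<bar>" using pos by simp
    show "V (u, v) \<le> (\<alpha> + \<beta> + \<bar>a\<bar> + \<bar>c\<bar>) * (\<bar>u\<bar> + \<bar>v\<bar>)" for u v
    proof (rule Vle)
      have "\<bar>a * v - c * u\<bar> \<le> \<bar>a\<bar> * \<bar>v\<bar> + \<bar>c\<bar> * \<bar>u\<bar>"
        using abs_triangle_ineq4[of "a * v" "c * u"] by (simp add: abs_mult)
      also have "\<dots> \<le> (\<alpha> + \<beta> + \<bar>a\<bar> + \<bar>c\<bar>) * \<bar>v\<bar> + (\<alpha> + \<beta> + \<bar>a\<bar> + \<bar>c\<bar>) * \<bar>u\<bar>"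
        using pos by (intro add_mono mult_right_mono) auto
      finally show "\<bar>a * v - c * u\<bar> \<le> (\<alpha> + \<beta> + \<bar>a\<bar> + \<bar>c\<bar>) * (\<bar>u\<bar> + \<bar>v\<bar>)"
        by (simp add: distrib_left add.commute)
    qed (use pos in \<open>auto intro!: mult_mono\<close>)
    show "(0::real) < 1" by simp
    show "V (shear_flow n a c t y) \<le> 1 * V y" if "0 \<le> t" for t y
      using shear[OF that, of y] mult_right_mono[OF f1[OF that] V0[of y]] by simp
    show "V (diag_flow p q s y) \<le> V y" if "0 \<le> s" for s y
      using diag[OF that, of y] mult_right_mono[of "exp (- p * s)" 1 "V y"] V0[of y] assms that
      by simp
    show "V (diag_flow p q s (shear_flow n a c t y)) \<le> V y" if "0 < t" "0 < s" for t s y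
    proof -
      have "exp (- p * s) * ((1 + n * t) * exp (- n * t)) \<le> 1 * 1"
        using that assms f1[of t] by (intro mult_mono) auto
      then show ?thesis using loop[of t s y] mult_right_mono[OF _ V0[of y]] that by fastforce
    qed
    show "\<exists>\<rho>. 0 \<le> \<rho> \<and> \<rho> < 1 \<and>
        (\<forall>t s y. 0 < t \<and> 0 < s \<and> 0 \<le> t \<and> 0 \<le> s \<and> (0 + \<eta> \<le> t \<or> 0 + \<eta> \<le> s) \<longrightarrow>
          V (diag_flow p q s (shear_flow n a c t y)) \<le> \<rho> * V y)" if "0 < \<eta>" for \<eta>
    proof (intro exI conjI allI impI)
      \<comment> \<open>The first entry is the contraction by a shear lasting at least
        \<open>\<eta>\<close>, the second that by a diagonal flow lasting at least
        \<open>\<eta>\<close>. The other flow of the loop does not expand.\<close>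
      let ?\<rho> = "max ((1 + n * \<eta>) * exp (- (n * \<eta>))) (exp (- p * \<eta>))"
      show "0 \<le> ?\<rho>" by (simp add: le_max_iff_disj)
      show "?\<rho> < 1" using one_plus_mult_exp_less_1[of "n * \<eta>"] that assms by simp
      fix t s y assume ts: "0 < t \<and> 0 < s \<and> 0 \<le> t \<and> 0 \<le> s \<and> (0 + \<eta> \<le> t \<or> 0 + \<eta> \<le> s)"
      have "exp (- p * s) * ((1 + n * t) * exp (- n * t)) \<le> ?\<rho>"
      proof (cases "\<eta> \<le> t")
        case True
        then have "(1 + n * t) * exp (- n * t) \<le> ?\<rho>"
          using one_plus_mult_exp_antimono[of "n * \<eta>" "n * t"] that assms by (simp add: le_max_iff_disj)
        moreover have "exp (- p * s) * ((1 + n * t) * exp (- n * t)) \<le> 1 * ((1 + n * t) * exp (- n * t))"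
          using ts assms by (intro mult_right_mono) auto
        ultimately show ?thesis by simp
      next
        case False
        then have "\<eta> \<le> s" using ts by simp
        then have "exp (- p * s) * ((1 + n * t) * exp (- n * t)) \<le> exp (- p * \<eta>) * 1"
          using ts assms f1[of t] by (intro mult_mono) auto
        then show ?thesis by simp
      qed
      then show "V (diag_flow p q s (shear_flow n a c t y)) \<le> ?\<rho> * V y"
        using loop[of t s y] mult_right_mono[OF _ V0[of y]] ts by (meson order_trans)
    qed
  qed
qed

section \<open>The critical inequality in exponential form\<close>

lemma critical_exp_form:
  fixes T \<delta> E e :: real
  defines "r \<equiv> exp (\<delta> - E)" and "h \<equiv> exp (2 * \<delta>)"
  assumes "T * cosh \<delta> \<le> sinh E + e * sinh \<delta>"
  shows "r * T * (1 + h) \<le> h - r\<^sup>2 + e * (h * r - r)"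
proof -
  define x w where "x = exp \<delta>" and "w = exp E"
  have xw: "0 < x" "0 < w" by (auto simp: x_def w_def)
  have r: "r = x / w" and h: "h = x\<^sup>2"
    by (auto simp: r_def h_def x_def w_def exp_diff exp_double)
  have "T * ((x + 1 / x) / 2) \<le> (w - 1 / w) / 2 + e * ((x - 1 / x) / 2)"
    using assms(3) by (simp add: cosh_field_def sinh_field_def x_def w_def exp_minus inverse_eq_divide)
  \<comment> \<open>As \<open>r = x / w\<close> and \<open>h\<close> is the square of
    \<open>x\<close>, multiplying by \<open>2 * x * r\<close> leaves only \<open>r\<close>,
    \<open>h\<close> and \<open>T\<close>.\<close>
  then have "(2 * x * r) * (T * ((x + 1 / x) / 2)) \<le> (2 * x * r) * ((w - 1 / w) / 2 + e * ((x - 1 / x) / 2))"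
    using xw by (intro mult_left_mono) (auto simp: r)
  moreover have "(2 * x * r) * (T * ((x + 1 / x) / 2)) = r * T * (1 + h)"
    using xw unfolding h by (simp add: field_simps power2_eq_square)
  moreover have "(2 * x * r) * ((w - 1 / w) / 2 + e * ((x - 1 / x) / 2)) = h - r\<^sup>2 + e * (h * r - r)"
    using xw unfolding h r by (simp add: field_simps power2_eq_square)
  ultimately show ?thesis by (simp only:)
qed

context
  fixes a c n p q \<tau> e :: real
  assumes pos: "0 < n" "0 < p" "p < q" "0 < \<tau>"
    and crit: "\<And>t. \<tau> \<le> t \<Longrightarrow> \<bar>a * c\<bar> * t * cosh ((q - p) / 2 * \<tau>)
      \<le> sinh ((q + p) / 2 * \<tau> + n * t) + e * sinh ((q - p) / 2 * \<tau>)"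
begin

text \<open>For a loop with dwell times \<open>t\<close> and \<open>\<tau>\<close>, \<open>r\<close>
  is the product of the decay of the shear flow and the slower diagonal decay; \<open>h\<close> is
  the ratio of the two diagonal decays. Longer stays in the second subsystem only shrink the factors
  to be estimated, so height \<open>\<tau>\<close> suffices.\<close>

lemma critical_bound:
  assumes "\<tau> \<le> t"
  defines "r \<equiv> exp (- p * \<tau> - n * t)" and "h \<equiv> exp ((q - p) * \<tau>)"
  shows "r * (\<bar>a * c\<bar> * t) * (1 + h) \<le> h - r\<^sup>2 + e * (h * r - r)"
proof -
  have "r = exp ((q - p) / 2 * \<tau> - ((q + p) / 2 * \<tau> + n * t))"
    unfolding r_def by (simp add: field_simps)
  moreover have "h = exp (2 * ((q - p) / 2 * \<tau>))" unfolding h_def by simp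
  ultimately show ?thesis using critical_exp_form[OF crit[OF assms(1)]] by simp
qed

lemma loop_decay_less_1: "exp (- (p + n) * \<tau>) < 1"
  using pos by (simp add: mult_neg_pos)

lemma loop_decay_le:
  assumes "\<tau> \<le> t" shows "exp (- p * \<tau> - n * t) \<le> exp (- (p + n) * \<tau>)"
  using assms pos by (simp add: algebra_simps)

lemma one_less_stretch: "1 < exp ((q - p) * \<tau>)"
  using pos by simp

text \<open>For \<open>a * c < 0\<close> both flows preserve the cone on which \<open>a * v\<close> and \<open>a * v - c * u\<close> have
  opposite signs. The norm is the \<open>L1\<close> norm in the coordinates given by its edges.\<close>

lemma cone_norm_loop_contracting:
  assumes neg: "a * c < 0" and e: "e = - 1"
  shows "\<exists>V. loop_contracting n p q a c \<tau> V"
proof -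
  define V :: "real \<times> real \<Rightarrow> real" where "V = (\<lambda>(u, v). \<bar>a * v - c * u\<bar> + \<bar>a * v\<bar>)"
  define h where "h = exp ((q - p) * \<tau>)"
  define R where "R = exp (- (p + n) * \<tau>)"
  have ac: "a \<noteq> 0" "c \<noteq> 0" using neg by auto
  have V0: "0 \<le> V y" for y by (cases y) (auto simp: V_def)
  have shear: "V (shear_flow n a c t y) \<le> (1 + \<bar>a * c\<bar> * t) * exp (- n * t) * V y" if "0 \<le> t" for t y
  proof -
    obtain u v where y: "y = (u, v)" by (cases y)
    let ?z = "a * v - c * u" and ?E = "exp (- n * t)"
    define Y where "Y = a * v + a * c * t * ?z"
    have "\<bar>a * v + a * c * t * ?z\<bar> \<le> \<bar>a * v\<bar> + \<bar>a * c\<bar> * t * \<bar>?z\<bar>"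
      using abs_triangle_ineq[of "a * v" "a * c * t * ?z"] that by (simp add: abs_mult)
    moreover have "0 \<le> \<bar>a * c\<bar> * t * \<bar>a * v\<bar>" using that by simp
    ultimately have "\<bar>?z\<bar> + \<bar>a * v + a * c * t * ?z\<bar> \<le> (1 + \<bar>a * c\<bar> * t) * (\<bar>?z\<bar> + \<bar>a * v\<bar>)"
      by (simp only: distrib_right distrib_left mult_1)
    then have le: "\<bar>?z\<bar> + \<bar>Y\<bar> \<le> (1 + \<bar>a * c\<bar> * t) * V y" by (simp only: V_def y Y_def prod.case)
    have "V (shear_flow n a c t y) = \<bar>?E * ?z\<bar> + \<bar>?E * Y\<bar>"
      unfolding V_def shear_flow_def y prod.case Y_def
      by (intro arg_cong2[where f = "(+)"] arg_cong[where f = abs]) (simp_all add: algebra_simps)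
    also have "\<dots> = ?E * (\<bar>?z\<bar> + \<bar>Y\<bar>)" by (simp add: abs_mult distrib_left)
    also have "\<dots> \<le> ?E * ((1 + \<bar>a * c\<bar> * t) * V y)" using le by (rule mult_left_mono) simp
    finally show ?thesis by (simp only: mult_ac)
  qed
  have diag: "V (diag_flow p q s y) \<le> exp (- p * s) * V y" if "0 \<le> s" for s y
  proof -
    obtain u v where y: "y = (u, v)" by (cases y)
    define \<theta> where "\<theta> = exp (- (q - p) * s)"
    have \<theta>: "0 < \<theta>" "\<theta> \<le> 1" using that pos by (auto simp: \<theta>_def mult_nonpos_nonneg)
    have q: "exp (- q * s) = exp (- p * s) * \<theta>" by (simp add: \<theta>_def exp_add[symmetric] algebra_simps)
    let ?E = "exp (- p * s)" and ?z = "a * v - c * u"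
    \<comment> \<open>Up to \<open>?E\<close>, the diagonal flow keeps the share
      \<open>\<theta>\<close> of \<open>a * v\<close> and passes the share
      \<open>1 - \<theta>\<close> to the other coordinate, so the \<open>L1\<close> sum cannot
      grow.\<close>
    have "\<bar>?z - (1 - \<theta>) * (a * v)\<bar> \<le> \<bar>?z\<bar> + (1 - \<theta>) * \<bar>a * v\<bar>"
      using \<theta> abs_triangle_ineq4[of ?z "(1 - \<theta>) * (a * v)"] by (simp add: abs_mult)
    then have "\<bar>?z - (1 - \<theta>) * (a * v)\<bar> + \<theta> * \<bar>a * v\<bar> \<le> \<bar>?z\<bar> + \<bar>a * v\<bar>"
      by (simp add: algebra_simps)
    then have "?E * (\<bar>?z - (1 - \<theta>) * (a * v)\<bar> + \<theta> * \<bar>a * v\<bar>) \<le> ?E * (\<bar>?z\<bar> + \<bar>a * v\<bar>)"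
      by (rule mult_left_mono) simp
    moreover have "V (diag_flow p q s y) = \<bar>?E * (?z - (1 - \<theta>) * (a * v))\<bar> + \<bar>?E * (\<theta> * (a * v))\<bar>"
      unfolding V_def diag_flow_def y prod.case q
      by (intro arg_cong2[where f = "(+)"] arg_cong[where f = abs]) (simp_all add: algebra_simps)
    ultimately show ?thesis using \<theta> by (simp add: V_def y abs_mult mult_ac distrib_left)
  qed
  \<comment> \<open>Adding \<open>r * (1 + h)\<close> to the critical bound completes a square and
    bounds the loop factor by \<open>1 - (1 - r)\<^sup>2 / (1 + h)\<close>. All loops have
    \<open>r \<le> R < 1\<close>, which makes the bound uniform.\<close>
  define \<rho> where "\<rho> = 1 - (1 - R)\<^sup>2 / (1 + h)"
  have h: "1 < h" unfolding h_def by (rule one_less_stretch)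
  have R: "0 < R" "R < 1" using loop_decay_less_1 by (auto simp: R_def)
  have "(1 - R)\<^sup>2 \<le> 1" using R by (simp add: power_le_one)
  then have \<rho>: "0 \<le> \<rho>" "\<rho> < 1" using R h by (auto simp: \<rho>_def)
  show ?thesis
  proof (intro exI loop_contracting_uniformI)
    show "0 < min \<bar>a\<bar> \<bar>c\<bar> / 2" using ac by simp
    show "min \<bar>a\<bar> \<bar>c\<bar> / 2 * (\<bar>u\<bar> + \<bar>v\<bar>) \<le> V (u, v)" for u v
    proof -
      have "min \<bar>a\<bar> \<bar>c\<bar> * \<bar>u\<bar> \<le> \<bar>c * u\<bar>" "min \<bar>a\<bar> \<bar>c\<bar> * \<bar>v\<bar> \<le> \<bar>a * v\<bar>"
        by (auto simp: abs_mult intro!: mult_right_mono)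
      moreover have "\<bar>c * u\<bar> \<le> V (u, v)" "\<bar>a * v\<bar> \<le> V (u, v)" by (auto simp: V_def)
      ultimately show ?thesis by (simp add: distrib_left)
    qed
    show "0 < 2 * \<bar>a\<bar> + \<bar>c\<bar>" using ac by simp
    show "V (u, v) \<le> (2 * \<bar>a\<bar> + \<bar>c\<bar>) * (\<bar>u\<bar> + \<bar>v\<bar>)" for u v
    proof -
      have "V (u, v) \<le> 2 * (\<bar>a\<bar> * \<bar>v\<bar>) + \<bar>c\<bar> * \<bar>u\<bar>"
        using abs_triangle_ineq4[of "a * v" "c * u"] by (simp add: V_def abs_mult)
      also have "\<dots> \<le> 2 * (\<bar>a\<bar> * \<bar>v\<bar>) + \<bar>c\<bar> * \<bar>u\<bar> + (2 * (\<bar>a\<bar> * \<bar>u\<bar>) + \<bar>c\<bar> * \<bar>v\<bar>)" by simp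
      finally show ?thesis by (simp add: algebra_simps)
    qed
    show "0 < 1 + \<bar>a * c\<bar> / n" using pos by (simp add: add_pos_nonneg)
    show "V (shear_flow n a c t y) \<le> (1 + \<bar>a * c\<bar> / n) * V y" if "0 \<le> t" for t y
      using shear[OF that, of y] mult_right_mono[OF one_plus_mult_exp_le[OF pos(1) _ that] V0[of y]]
      by (meson abs_ge_zero order_trans)
    show "V (diag_flow p q s y) \<le> V y" if "0 \<le> s" for s y
      using diag[OF that, of y] mult_right_mono[of "exp (- p * s)" 1 "V y"] V0[of y] pos that
      by simp
    show "0 \<le> \<rho>" "\<rho> < 1" by fact+
    show "V (diag_flow p q s (shear_flow n a c t y)) \<le> \<rho> * V y"
      if ts: "0 < t" "0 < s" "\<tau> \<le> t" "\<tau> \<le> s" for t s y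
    proof -
      define r where "r = exp (- p * \<tau> - n * t)"
      have r: "0 < r" "r \<le> R" unfolding r_def R_def using loop_decay_le[OF ts(3)] by simp_all
      have "exp (- p * s) \<le> exp (- p * \<tau>)" using ts pos by simp
      then have "exp (- p * s) * ((1 + \<bar>a * c\<bar> * t) * exp (- n * t))
          \<le> exp (- p * \<tau>) * ((1 + \<bar>a * c\<bar> * t) * exp (- n * t))"
        using ts by (intro mult_right_mono mult_nonneg_nonneg) auto
      also have "\<dots> = (1 + \<bar>a * c\<bar> * t) * r" by (simp add: r_def exp_diff exp_minus field_simps)
      also have "\<dots> \<le> 1 - (1 - r)\<^sup>2 / (1 + h)"
      proof -
        have "r * (\<bar>a * c\<bar> * t) * (1 + h) \<le> h - r\<^sup>2 - (h * r - r)"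
          using critical_bound[OF ts(3)] unfolding e r_def[symmetric] h_def[symmetric] by simp
        then have "(1 + \<bar>a * c\<bar> * t) * r * (1 + h) \<le> 1 + h - (1 - r)\<^sup>2"
          by (simp add: algebra_simps power2_eq_square)
        then show ?thesis using h by (simp add: field_simps)
      qed
      also have "\<dots> \<le> \<rho>"
        unfolding \<rho>_def using r R h by (intro diff_left_mono divide_right_mono power_mono) auto
      finally have "exp (- p * s) * ((1 + \<bar>a * c\<bar> * t) * exp (- n * t)) * V y \<le> \<rho> * V y"
        using V0 by (rule mult_right_mono)
      moreover have "V (diag_flow p q s (shear_flow n a c t y))
          \<le> exp (- p * s) * ((1 + \<bar>a * c\<bar> * t) * exp (- n * t) * V y)"
        using ts by (intro order_trans[OF diag] mult_left_mono shear) auto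
      ultimately show ?thesis by (simp add: mult.assoc)
    qed
  qed
qed

text \<open>For \<open>a * c > 0\<close> a loop rotates. The width \<open>m\<close> of the hexagonal unit ball must be small enough
  for the bound on \<open>c * u\<close> and large enough for the bound on \<open>a * v\<close>; the critical inequality
  leaves room for \<open>m = 2 / (1 + h)\<close>, whichever loops are combined.\<close>

lemma hexagon_norm_loop_contracting:
  assumes k: "0 < a * c" and e: "e = 1"
  shows "\<exists>V. loop_contracting n p q a c \<tau> V"
proof -
  define h where "h = exp ((q - p) * \<tau>)"
  define R where "R = exp (- (p + n) * \<tau>)"
  define m where "m = 2 / (1 + h)"
  define V :: "real \<times> real \<Rightarrow> real" where
    "V = (\<lambda>(u, v). max (max \<bar>c * u\<bar> \<bar>a * v - c * u\<bar>) (\<bar>a * v\<bar> / m))"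
  have ac: "a \<noteq> 0" "c \<noteq> 0" using k by auto
  have h: "1 < h" unfolding h_def by (rule one_less_stretch)
  have R: "0 < R" "R < 1" using loop_decay_less_1 by (auto simp: R_def)
  have m: "0 < m" "m < 1" using h by (auto simp: m_def)
  have V0: "0 \<le> V y" for y by (cases y) (auto simp: V_def)
  have Vge: "\<bar>c * u\<bar> \<le> V (u, v)" "\<bar>a * v - c * u\<bar> \<le> V (u, v)" for u v
    by (auto simp: V_def)
  have Vge3: "\<bar>a * v\<bar> \<le> m * V (u, v)" for u v
  proof -
    have "\<bar>a * v\<bar> / m \<le> V (u, v)" by (auto simp: V_def)
    then show ?thesis using m by (simp add: field_simps)
  qed
  have Vle: "V (u, v) \<le> M" if "\<bar>c * u\<bar> \<le> M" "\<bar>a * v - c * u\<bar> \<le> M" "\<bar>a * v\<bar> \<le> m * M" for u v M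
    using that m by (auto simp: V_def field_simps)
  have "m * V y \<le> V y" for y using m V0[of y] mult_right_mono[of m 1 "V y"] by simp
  \<comment> \<open>For \<open>T \<le> 1\<close> the sheared \<open>x\<close> is a convex
    combination of \<open>x\<close> and \<open>w\<close>; for larger \<open>T\<close> it is
    \<open>w + (T - 1) * z\<close>. Using \<open>z = w - x\<close> in this way is sharper than
    adding the bounds for \<open>x\<close> and \<open>T * z\<close>.\<close>
  have sheared: "\<bar>x + T * z\<bar> \<le> max 1 (m + T - 1) * M" "\<bar>w + T * z\<bar> \<le> (m + T) * M"
    if "0 \<le> T" "z = w - x" "\<bar>x\<bar> \<le> M" "\<bar>z\<bar> \<le> M" "\<bar>w\<bar> \<le> m * M" for x z w T M
  proof -
    have M: "0 \<le> M" using that by linarith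
    have Tz: "\<bar>T * z\<bar> \<le> T * M" using that by (simp add: abs_mult mult_left_mono)
    then show "\<bar>w + T * z\<bar> \<le> (m + T) * M" using that by (simp add: distrib_right)
    show "\<bar>x + T * z\<bar> \<le> max 1 (m + T - 1) * M"
    proof (cases "T \<le> 1")
      case True
      have "x + T * z = (1 - T) * x + T * w" unfolding that(2) by (simp add: algebra_simps)
      then have "\<bar>x + T * z\<bar> \<le> (1 - T) * \<bar>x\<bar> + T * \<bar>w\<bar>"
        using True that abs_triangle_ineq[of "(1 - T) * x" "T * w"] by (simp add: abs_mult)
      also have "\<dots> \<le> (1 - T) * M + T * (1 * M)"
        using True that M m mult_right_mono[of m 1 M] by (intro add_mono mult_left_mono) auto
      also have "\<dots> = 1 * M" by (simp add: algebra_simps)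
      also have "\<dots> \<le> max 1 (m + T - 1) * M" using M by (intro mult_right_mono) auto
      finally show ?thesis .
    next
      case False
      have "x + T * z = w + (T - 1) * z" unfolding that(2) by (simp add: algebra_simps)
      then have "\<bar>x + T * z\<bar> \<le> \<bar>w\<bar> + (T - 1) * \<bar>z\<bar>"
        using False abs_triangle_ineq[of w "(T - 1) * z"] by (simp add: abs_mult)
      also have "\<dots> \<le> m * M + (T - 1) * M"
        using False that by (intro add_mono mult_left_mono) auto
      also have "\<dots> = (m + T - 1) * M" by (simp add: algebra_simps)
      also have "\<dots> \<le> max 1 (m + T - 1) * M" using M by (intro mult_right_mono) auto
      finally show ?thesis .
    qed
  qed
  \<comment> \<open>Conditions \<open>b1\<close> and \<open>b2\<close> come from the faces for
    \<open>c * u\<close> and \<open>a * v\<close>. The third face follows from \<open>b1\<close>, as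
    the new difference is a signed convex combination of the old one and the new
    \<open>c * u\<close>. Allowing \<open>s = 0\<close> or \<open>t = 0\<close> covers each flow by
    itself.\<close>
  have loop: "V (diag_flow p q s (shear_flow n a c t (u, v))) \<le> \<sigma> * V (u, v)"
    if ts: "0 \<le> t" "0 \<le> s"
      and b1: "exp (- p * s - n * t) * max 1 (m + a * c * t - 1) \<le> \<sigma>"
      and b2: "exp (- q * s - n * t) * (m + a * c * t) \<le> m * \<sigma>" for t s u v \<sigma>
  proof -
    define T where "T = a * c * t"
    define \<theta> where "\<theta> = exp (- (q - p) * s)"
    define r where "r = exp (- p * s - n * t)"
    define x z w where "x = c * u" "z = a * v - c * u" "w = a * v"
    define M where "M = V (u, v)"
    define X where "X = max 1 (m + T - 1)"
    have T: "0 \<le> T" using k ts by (simp add: T_def)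
    have \<theta>: "0 < \<theta>" "\<theta> \<le> 1" using ts pos by (auto simp: \<theta>_def mult_nonpos_nonneg)
    have r: "0 < r" by (simp add: r_def)
    have M: "0 \<le> M" unfolding M_def by (rule V0)
    have xwz: "\<bar>x\<bar> \<le> M" "\<bar>z\<bar> \<le> M" "\<bar>w\<bar> \<le> m * M" "z = w - x"
      using Vge(1)[of u v] Vge(2)[of v u] Vge3[of v u] unfolding x_z_w_def M_def by auto
    note bd = sheared[OF T xwz(4,1-3), folded X_def]
    have rX: "r * X \<le> \<sigma>" using b1 unfolding r_def X_def T_def .
    have r\<theta>: "exp (- q * s - n * t) = r * \<theta>" unfolding r_def \<theta>_def by (simp add: exp_add[symmetric] algebra_simps)
    have c1: "\<bar>r * (x + T * z)\<bar> \<le> \<sigma> * M"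
    proof -
      have "\<bar>r * (x + T * z)\<bar> \<le> r * (X * M)"
        using r bd(1) by (simp add: abs_mult)
      also have "\<dots> \<le> \<sigma> * M" using mult_right_mono[OF rX M] by (simp add: mult.assoc)
      finally show ?thesis .
    qed
    have c2: "\<bar>r * (\<theta> * z - (1 - \<theta>) * (x + T * z))\<bar> \<le> \<sigma> * M"
    proof -
      have "\<bar>\<theta> * z - (1 - \<theta>) * (x + T * z)\<bar> \<le> \<theta> * \<bar>z\<bar> + (1 - \<theta>) * \<bar>x + T * z\<bar>"
        using \<theta> abs_triangle_ineq4[of "\<theta> * z" "(1 - \<theta>) * (x + T * z)"] by (simp add: abs_mult)
      also have "\<dots> \<le> \<theta> * (X * M) + (1 - \<theta>) * (X * M)"
        using \<theta> xwz(2) bd(1) M mult_right_mono[of 1 X M]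
        by (intro add_mono mult_left_mono) (auto simp: X_def)
      also have "\<dots> = X * M" by (simp add: algebra_simps)
      finally have "\<bar>r * (\<theta> * z - (1 - \<theta>) * (x + T * z))\<bar> \<le> r * (X * M)"
        using r by (simp add: abs_mult)
      also have "\<dots> \<le> \<sigma> * M" using mult_right_mono[OF rX M] by (simp add: mult.assoc)
      finally show ?thesis .
    qed
    have c3: "\<bar>r * \<theta> * (w + T * z)\<bar> \<le> m * (\<sigma> * M)"
    proof -
      have "\<bar>r * \<theta> * (w + T * z)\<bar> \<le> r * \<theta> * ((m + T) * M)"
        using r \<theta> bd(2) by (simp add: abs_mult)
      also have "\<dots> \<le> m * \<sigma> * M"
        using mult_right_mono[OF b2 M] unfolding r\<theta> T_def by (simp add: mult.assoc)
      finally show ?thesis by (simp add: mult.assoc)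
    qed
    have x1: "c * (exp (- p * s) * (exp (- n * t) * (u + t * z * a))) = r * (x + T * z)"
      and w1: "a * (exp (- q * s) * (exp (- n * t) * (v + t * z * c))) = r * \<theta> * (w + T * z)"
      unfolding r\<theta>[symmetric]
      by (simp_all add: r_def exp_diff exp_minus x_z_w_def(1,3) T_def field_simps)
    have "r * \<theta> * (w + T * z) - r * (x + T * z) = r * (\<theta> * z - (1 - \<theta>) * (x + T * z))"
      unfolding xwz(4) by (simp add: algebra_simps)
    then have "\<bar>r * \<theta> * (w + T * z) - r * (x + T * z)\<bar> \<le> \<sigma> * M" using c2 by simp
    then show ?thesis
      unfolding shear_flow_def diag_flow_def prod.case x_z_w_def(2)[symmetric] M_def[symmetric]
      using c1 c3 by (intro Vle) (simp_all only: x1 w1)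
  qed
  \<comment> \<open>The entries \<open>R\<close> and \<open>h / (1 + h)\<close> serve the two
    branches of the maximum in \<open>b1\<close>; the last entry serves \<open>b2\<close>.\<close>
  define \<rho> where "\<rho> = max (max R (h / (1 + h))) (1 - (1 - R)\<^sup>2 / 2)"
  have \<rho>: "0 \<le> \<rho>" "\<rho> < 1" using R h by (auto simp: \<rho>_def le_max_iff_disj)
  define B where "B = 1 + a * c / m / n"
  have ac0: "0 \<le> a * c / m" using k m by simp
  show ?thesis
  proof (intro exI loop_contracting_uniformI)
    show "0 < min \<bar>a\<bar> \<bar>c\<bar> / 2" using ac by simp
    show "min \<bar>a\<bar> \<bar>c\<bar> / 2 * (\<bar>u\<bar> + \<bar>v\<bar>) \<le> V (u, v)" for u v
    proof -
      have "min \<bar>a\<bar> \<bar>c\<bar> * \<bar>u\<bar> \<le> \<bar>c * u\<bar>" "min \<bar>a\<bar> \<bar>c\<bar> * \<bar>v\<bar> \<le> \<bar>a * v\<bar>"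
        by (auto simp: abs_mult intro!: mult_right_mono)
      moreover have "\<bar>a * v\<bar> \<le> V (u, v)"
        using Vge3[of v u] \<open>m * V (u, v) \<le> V (u, v)\<close> by linarith
      ultimately show ?thesis using Vge(1)[of u v] by (simp add: distrib_left)
    qed
    show "0 < (\<bar>a\<bar> + \<bar>c\<bar>) / m" using ac m by simp
    show "V (u, v) \<le> (\<bar>a\<bar> + \<bar>c\<bar>) / m * (\<bar>u\<bar> + \<bar>v\<bar>)" for u v
    proof -
      define S where "S = (\<bar>a\<bar> + \<bar>c\<bar>) * (\<bar>u\<bar> + \<bar>v\<bar>)"
      have "0 \<le> \<bar>a\<bar> * \<bar>u\<bar>" "0 \<le> \<bar>c\<bar> * \<bar>v\<bar>" "0 \<le> \<bar>a\<bar> * \<bar>v\<bar>" "0 \<le> \<bar>c\<bar> * \<bar>u\<bar>" by simp_all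
      moreover have "S = \<bar>a\<bar> * \<bar>u\<bar> + \<bar>c\<bar> * \<bar>v\<bar> + \<bar>a\<bar> * \<bar>v\<bar> + \<bar>c\<bar> * \<bar>u\<bar>"
        by (simp add: S_def algebra_simps)
      moreover have "\<bar>a * v - c * u\<bar> \<le> \<bar>a\<bar> * \<bar>v\<bar> + \<bar>c\<bar> * \<bar>u\<bar>"
        using abs_triangle_ineq4[of "a * v" "c * u"] by (simp add: abs_mult)
      ultimately have S: "\<bar>c * u\<bar> \<le> S" "\<bar>a * v - c * u\<bar> \<le> S" "\<bar>a * v\<bar> \<le> S" "0 \<le> S"
        by (simp_all only: abs_mult)
      have "S * m \<le> S * 1" using m S by (intro mult_left_mono) auto
      then have "S \<le> S / m" using m by (simp add: field_simps)
      moreover have "m * (S / m) = S" using m by simp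
      ultimately have "V (u, v) \<le> S / m" using S by (intro Vle; linarith)
      then show ?thesis by (simp add: S_def)
    qed
    have "0 \<le> a * c / m / n" by (rule divide_nonneg_pos[OF ac0 pos(1)])
    then show "0 < B" unfolding B_def by linarith
    show "V (shear_flow n a c t y) \<le> B * V y" if "0 \<le> t" for t y
    proof -
      obtain u v where y: "y = (u, v)" by (cases y)
      have f: "(1 + a * c / m * t) * exp (- n * t) \<le> B"
        unfolding B_def by (rule one_plus_mult_exp_le[OF pos(1) ac0 that])
      have "a * c * t * m \<le> a * c * t * 1"
        using m k that by (intro mult_left_mono) auto
      then have "a * c * t \<le> a * c * t / m" using m by (simp add: field_simps)
      then have "max 1 (m + a * c * t - 1) \<le> 1 + a * c / m * t"
        using m k that by simp
      then have "exp (- n * t) * max 1 (m + a * c * t - 1) \<le> exp (- n * t) * (1 + a * c / m * t)"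
        by (rule mult_left_mono) simp
      also have "\<dots> \<le> B" using f by (simp only: mult.commute)
      finally have "exp (- n * t) * max 1 (m + a * c * t - 1) \<le> B" .
      moreover have "exp (- n * t) * (m + a * c * t) \<le> m * B"
      proof -
        have "m + a * c * t = m * (1 + a * c / m * t)" using m by (simp add: field_simps)
        then have "exp (- n * t) * (m + a * c * t) = m * ((1 + a * c / m * t) * exp (- n * t))"
          by (simp only: mult_ac)
        also have "\<dots> \<le> m * B" using f m by (intro mult_left_mono) auto
        finally show ?thesis .
      qed
      moreover have "diag_flow p q 0 = id" by (auto simp: diag_flow_def)
      ultimately show ?thesis using loop[of t 0 B u v] that by (simp add: y)
    qed
    show "V (diag_flow p q s y) \<le> V y" if "0 \<le> s" for s y
    proof -
      obtain u v where y: "y = (u, v)" by (cases y)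
      have "shear_flow n a c 0 = id" by (auto simp: shear_flow_def)
      moreover have "exp (- p * s) * max 1 (m - 1) \<le> 1" using m pos that by simp
      moreover have "exp (- q * s) * m \<le> m * 1" using m pos that by simp
      ultimately show ?thesis using loop[of 0 s 1 u v] that by (simp add: y)
    qed
    show "0 \<le> \<rho>" "\<rho> < 1" by fact+
    show "V (diag_flow p q s (shear_flow n a c t y)) \<le> \<rho> * V y"
      if ts: "0 < t" "0 < s" "\<tau> \<le> t" "\<tau> \<le> s" for t s y
    proof -
      obtain u v where y: "y = (u, v)" by (cases y)
      define T where "T = a * c * t"
      define r where "r = exp (- p * \<tau> - n * t)"
      have T: "0 \<le> T" using k ts by (simp add: T_def)
      have r: "0 < r" "r \<le> R" unfolding r_def R_def using loop_decay_le[OF ts(3)] by simp_all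
      have crit: "r * T * (1 + h) \<le> h - r\<^sup>2 + (h * r - r)"
        using critical_bound[OF ts(3)] k unfolding e r_def[symmetric] h_def[symmetric]
        by (simp add: T_def)
      have rs: "exp (- p * s - n * t) \<le> r" using ts pos by (simp add: r_def)
      have X: "r * max 1 (m + T - 1) \<le> \<rho>"
      proof -
        have "r * (m + T - 1) * (1 + h) = 2 * r + r * T * (1 + h) - r * (1 + h)"
          using h by (simp add: m_def field_simps)
        also have "\<dots> \<le> h"
        proof -
          have "r * (1 + h) = r + h * r" by (simp add: algebra_simps)
          then show ?thesis using crit zero_le_power2[of r] by linarith
        qed
        finally have "r * (m + T - 1) \<le> h / (1 + h)" using h by (simp add: field_simps)
        then have "r * 1 \<le> \<rho>" "r * (m + T - 1) \<le> \<rho>"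
          using r by (simp_all add: \<rho>_def le_max_iff_disj)
        then show ?thesis by (cases "1 \<le> m + T - 1") (simp_all only: max_def if_True if_False)
      qed
      have "exp (- p * s - n * t) * max 1 (m + T - 1) \<le> r * max 1 (m + T - 1)"
        using rs by (intro mult_right_mono) auto
      then have b1: "exp (- p * s - n * t) * max 1 (m + T - 1) \<le> \<rho>" using X by linarith
      have "(q - p) * \<tau> \<le> (q - p) * s" using pos ts by simp
      then have "exp (- q * s - n * t) * h \<le> exp (- p * s - n * t)"
        unfolding h_def exp_add[symmetric] by (simp add: algebra_simps)
      then have "exp (- q * s - n * t) \<le> r / h" using rs h by (simp add: field_simps)
      then have "exp (- q * s - n * t) * (m + T) \<le> r / h * (m + T)"
        using m T by (intro mult_right_mono) auto
      also have "\<dots> \<le> m * \<rho>"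
      proof -
        \<comment> \<open>Replacing \<open>r - r\<^sup>2\<close> by \<open>h\<close> times itself
          makes \<open>h\<close> a common factor, after which a square can be completed.\<close>
        have "h * (r - r\<^sup>2) \<ge> 1 * (r - r\<^sup>2)"
          using h r R by (intro mult_right_mono) (auto simp: power2_eq_square mult_left_le)
        then have "2 * r + r * T * (1 + h) \<le> h * (1 + 2 * r - r\<^sup>2)"
          using crit by (simp add: algebra_simps)
        also have "\<dots> = 2 * h * (1 - (1 - r)\<^sup>2 / 2)" by (simp add: power2_eq_square field_simps)
        also have "\<dots> \<le> 2 * h * (1 - (1 - R)\<^sup>2 / 2)"
          using r R h by (intro mult_left_mono diff_left_mono divide_right_mono power_mono) auto
        also have "\<dots> \<le> 2 * h * \<rho>" using h by (intro mult_left_mono) (auto simp: \<rho>_def)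
        finally have "r * (2 + T * (1 + h)) \<le> 2 * h * \<rho>" by (simp add: algebra_simps)
        then have "r * (2 + T * (1 + h)) / (h * (1 + h)) \<le> 2 * h * \<rho> / (h * (1 + h))"
          using h by (intro divide_right_mono) auto
        moreover have "r / h * (m + T) = r * (2 + T * (1 + h)) / (h * (1 + h))"
          using h by (simp add: m_def field_simps)
        moreover have "m * \<rho> = 2 * h * \<rho> / (h * (1 + h))"
          using h by (simp add: m_def)
        ultimately show ?thesis by (simp only:)
      qed
      finally have "exp (- q * s - n * t) * (m + T) \<le> m * \<rho>" .
      with b1 show ?thesis using ts unfolding y T_def by (intro loop) auto
    qed
  qed
qed

end

section \<open>Signals and trajectories\<close>

text \<open>Right-continuity extends the constant value to the left end of each dwell interval.
  Equal values on consecutive intervals would make the signal continuous at a switching time, so the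
  two values alternate.\<close>

lemma signal_with_value:
  assumes sig: "signal_with \<sigma> d" and t: "d k \<le> t" "t < d (Suc k)"
  shows "\<sigma> t = (if even k then 1 else 2)"
proof -
  have mono: "strict_mono d" and d0: "d 0 = 0" and s0: "\<sigma> 0 = 1"
    and val: "\<And>t. 0 \<le> t \<Longrightarrow> \<sigma> t \<in> {1, 2}"
    and right: "\<And>t. 0 \<le> t \<Longrightarrow> continuous (at_right t) \<sigma>"
    and disc: "{t. 0 < t \<and> \<not> isCont \<sigma> t} = d ` {1..}"
    and const: "\<And>k. \<sigma> constant_on {d k<..<d (Suc k)}"
    using sig unfolding signal_with_def by blast+
  have less: "d k < d (Suc k)" for k using mono by (simp add: strict_mono_less)
  have dpos: "0 \<le> d k" for k using mono d0 by (metis le0 strict_mono_less_eq)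
  have at_right: "\<forall>\<^sub>F s in at_right (d k). \<sigma> s = \<sigma> (d k)" for k
    using right[OF dpos[of k]] by (simp add: continuous_within tendsto_discrete)
  have seg: "\<sigma> s = \<sigma> (d k)" if "d k \<le> s" "s < d (Suc k)" for k s
  proof (cases "s = d k")
    case False
    have "\<forall>\<^sub>F s in at_right (d k). s \<in> {d k<..<d (Suc k)}"
      by (rule eventually_at_right_real[OF less])
    with at_right[of k] have "\<exists>r. \<sigma> r = \<sigma> (d k) \<and> r \<in> {d k<..<d (Suc k)}"
      by (intro eventually_happens'[OF trivial_limit_at_right_real]) (rule eventually_conj)
    moreover obtain v where "\<And>r. r \<in> {d k<..<d (Suc k)} \<Longrightarrow> \<sigma> r = v"
      using const[of k] unfolding constant_on_def by blast
    moreover have "s \<in> {d k<..<d (Suc k)}" using that False by simp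
    ultimately show ?thesis by metis
  qed simp
  have switch: "\<sigma> (d (Suc k)) \<noteq> \<sigma> (d k)" for k
  proof
    assume eq: "\<sigma> (d (Suc k)) = \<sigma> (d k)"
    have "\<forall>\<^sub>F s in at_left (d (Suc k)). s \<in> {d k<..<d (Suc k)}"
      by (rule eventually_at_left_real[OF less])
    then have "\<forall>\<^sub>F s in at_left (d (Suc k)). \<sigma> s = \<sigma> (d (Suc k))"
      by eventually_elim (use seg eq in auto)
    with at_right[of "Suc k"] have "isCont \<sigma> (d (Suc k))"
      by (simp add: continuous_within tendsto_discrete eventually_at_split)
    moreover have "d (Suc k) \<in> d ` {1..}" by simp
    ultimately show False using disc by blast
  qed
  have "\<sigma> (d k) = (if even k then 1 else 2)"
  proof (induction k)
    case (Suc k)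
    then show ?case using switch[of k] val[OF dpos[of "Suc k"]] by (auto split: if_splits)
  qed (simp add: d0 s0)
  then show ?thesis using seg[OF t] by simp
qed

text \<open>A strictly increasing sequence is determined by its range. This reconciles the two
  separately quantified sequences in \<open>dwell_signals'\<close>.\<close>

lemma signal_with_unique:
  assumes "signal_with \<sigma> d" "signal_with \<sigma> d'"
  shows "d = d'"
proof -
  have le: "d' (Suc k) \<le> d (Suc k)"
    if "strict_mono d" "strict_mono d'" "d ` {1..} = d' ` {1..}" "d k = d' k"
    for d d' :: "nat \<Rightarrow> real" and k
  proof -
    have "d (Suc k) \<in> d ` {1..}" by simp
    then have "d (Suc k) \<in> d' ` {1..}" unfolding that(3) .
    then obtain m where m: "d (Suc k) = d' m" by (rule imageE)
    have "d' k < d' m" using that(1,4) m by (metis lessI strict_mono_less)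
    then have "Suc k \<le> m" using that(2) by (simp add: strict_mono_less)
    then show ?thesis using that(2) m by (simp add: strict_mono_less_eq)
  qed
  have *: "strict_mono d" "strict_mono d'" "d ` {1..} = d' ` {1..}" "d 0 = 0" "d' 0 = 0"
    using assms unfolding signal_with_def by auto
  have "d k = d' k" for k
  proof (induction k)
    case (Suc k)
    then show ?case using le[OF *(1-3), of k] le[OF *(2,1) *(3)[symmetric], of k] by simp
  qed (simp add: *)
  then show ?thesis by blast
qed

lemma dwell_interval:
  fixes d :: "nat \<Rightarrow> real"
  assumes "d m \<le> t" "filterlim d at_top sequentially"
  shows "\<exists>k\<ge>m. d k \<le> t \<and> t < d (Suc k)"
proof -
  have "\<forall>\<^sub>F k in sequentially. m \<le> k \<and> t < d k"
    using assms(2) by (intro eventually_conj eventually_ge_at_top) (simp add: filterlim_at_top_dense)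
  then obtain N where N: "m \<le> N" "t < d N" unfolding eventually_sequentially by blast
  show ?thesis
    using N
  proof (induction N rule: dec_induct)
    case base
    then show ?case using assms(1) by simp
  next
    case (step k)
    then show ?case by (cases "t < d k") auto
  qed
qed

section \<open>Explicit solutions between switching times\<close>

lemma linear_ode_resonant:
  fixes f :: "real \<Rightarrow> real"
  assumes "u \<le> v" "continuous_on {u..v} f"
    and "\<And>t. u < t \<Longrightarrow> t < v \<Longrightarrow>
      (f has_real_derivative - \<mu> * f t + C * exp (- \<mu> * (t - u))) (at t)"
  shows "f v = exp (- \<mu> * (v - u)) * (f u + (v - u) * C)"
proof (cases "u = v")
  case False
  \<comment> \<open>The integrating factor turns the forcing, which decays at the same rate
    \<open>\<mu>\<close>, into the constant \<open>C\<close>; subtracting \<open>C * (t - u)\<close>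
    leaves a constant function.\<close>
  let ?g = "\<lambda>t. exp (\<mu> * (t - u)) * f t - C * (t - u)"
  have "?g v = ?g u"
  proof (rule DERIV_isconst_end[of u v ?g])
    show "u < v" using assms(1) False by simp
    show "continuous_on {u..v} ?g" by (intro continuous_intros assms(2))
    fix t assume t: "u < t" "t < v"
    have "(?g has_real_derivative \<mu> * exp (\<mu> * (t - u)) * f t
        + exp (\<mu> * (t - u)) * (- \<mu> * f t + C * exp (- \<mu> * (t - u))) - C) (at t)"
      by (rule derivative_eq_intros assms(3)[OF t] refl | simp)+
    moreover have "exp (\<mu> * (t - u)) * exp (- \<mu> * (t - u)) = 1"
      by (simp add: exp_add[symmetric])
    ultimately show "(?g has_real_derivative 0) (at t)"
      by (simp add: algebra_simps)
  qed
  then have "exp (\<mu> * (v - u)) * f v = f u + (v - u) * C" by (simp add: algebra_simps)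
  then have "exp (- \<mu> * (v - u)) * (exp (\<mu> * (v - u)) * f v)
      = exp (- \<mu> * (v - u)) * (f u + (v - u) * C)" by (rule arg_cong)
  then show ?thesis by (simp add: mult.assoc[symmetric] exp_add[symmetric])
qed simp

lemma linear_ode_homogeneous:
  fixes f :: "real \<Rightarrow> real"
  assumes "u \<le> v" "continuous_on {u..v} f"
    and "\<And>t. u < t \<Longrightarrow> t < v \<Longrightarrow> (f has_real_derivative - \<mu> * f t) (at t)"
  shows "f v = exp (- \<mu> * (v - u)) * f u"
  using linear_ode_resonant[of u v f \<mu> 0] assms by simp

lemma diag_flow_unique:
  fixes f g :: "real \<Rightarrow> real"
  assumes "u \<le> v" "continuous_on {u..v} f" "continuous_on {u..v} g"
    and "\<And>t. u < t \<Longrightarrow> t < v \<Longrightarrow> (f has_real_derivative - p * f t) (at t)"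
    and "\<And>t. u < t \<Longrightarrow> t < v \<Longrightarrow> (g has_real_derivative - q * g t) (at t)"
  shows "(f v, g v) = diag_flow p q (v - u) (f u, g u)"
  using linear_ode_homogeneous[OF assms(1,2,4)] linear_ode_homogeneous[OF assms(1,3,5)]
  by (simp add: diag_flow_def)

lemma shear_flow_unique:
  fixes f g :: "real \<Rightarrow> real"
  assumes uv: "u \<le> v" and cont: "continuous_on {u..v} f" "continuous_on {u..v} g"
    and f: "\<And>t. u < t \<Longrightarrow> t < v \<Longrightarrow>
      (f has_real_derivative - n * f t + (a * g t - c * f t) * a) (at t)"
    and g: "\<And>t. u < t \<Longrightarrow> t < v \<Longrightarrow>
      (g has_real_derivative - n * g t + (a * g t - c * f t) * c) (at t)"
  shows "(f v, g v) = shear_flow n a c (v - u) (f u, g u)"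
proof -
  \<comment> \<open>The shear terms cancel in \<open>z\<close>, which therefore decays at rate
    \<open>n\<close>. Inserted into the equations for \<open>f\<close> and \<open>g\<close>, it is a
    forcing at their own rate, as for a Jordan block.\<close>
  define z where "z = (\<lambda>t. a * g t - c * f t)"
  have z: "z t = exp (- n * (t - u)) * z u" if "u \<le> t" "t \<le> v" for t
  proof (rule linear_ode_homogeneous[OF that(1)])
    show "continuous_on {u..t} z"
      unfolding z_def using that by (intro continuous_intros cont[THEN continuous_on_subset]) auto
    fix s assume s: "u < s" "s < t"
    then have s': "s < v" using that by simp
    show "(z has_real_derivative - n * z s) (at s)"
      unfolding z_def
      by (rule derivative_eq_intros f[OF s(1) s'] g[OF s(1) s'] refl)+ (simp add: algebra_simps)
  qed
  have "f v = exp (- n * (v - u)) * (f u + (v - u) * (z u * a))"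
  proof (rule linear_ode_resonant[OF uv cont(1)])
    fix t assume t: "u < t" "t < v"
    have "- n * f t + z u * a * exp (- n * (t - u)) = - n * f t + z t * a"
      using z[of t] t by simp
    then show "(f has_real_derivative - n * f t + z u * a * exp (- n * (t - u))) (at t)"
      using f[OF t] by (simp only: z_def)
  qed
  moreover have "g v = exp (- n * (v - u)) * (g u + (v - u) * (z u * c))"
  proof (rule linear_ode_resonant[OF uv cont(2)])
    fix t assume t: "u < t" "t < v"
    have "- n * g t + z u * c * exp (- n * (t - u)) = - n * g t + z t * c"
      using z[of t] t by simp
    then show "(g has_real_derivative - n * g t + z u * c * exp (- n * (t - u))) (at t)"
      using g[OF t] by (simp only: z_def)
  qed
  ultimately show ?thesis by (simp add: shear_flow_def z_def mult.assoc)
qed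

section \<open>Decay along the loops of a trajectory\<close>

locale loop_trajectory =
  fixes n p q a c \<tau> :: real and V :: "real \<times> real \<Rightarrow> real"
    and d :: "nat \<Rightarrow> real" and Y :: "real \<Rightarrow> real \<times> real"
  assumes contracting: "loop_contracting n p q a c \<tau> V"
    and mono: "strict_mono d" and unbounded: "filterlim d at_top sequentially"
    and dwell: "\<And>i. \<tau> \<le> d (2 * i + 1) - d (2 * i) \<and> \<tau> \<le> d (2 * i + 2) - d (2 * i + 1)"
    and shear: "\<And>i t. d (2 * i) \<le> t \<Longrightarrow> t \<le> d (2 * i + 1) \<Longrightarrow>
      Y t = shear_flow n a c (t - d (2 * i)) (Y (d (2 * i)))"
    and diag: "\<And>i t. d (2 * i + 1) \<le> t \<Longrightarrow> t \<le> d (2 * i + 2) \<Longrightarrow>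
      Y t = diag_flow p q (t - d (2 * i + 1)) (Y (d (2 * i + 1)))"
begin

lemmas contracting_conds = contracting[unfolded loop_contracting_def]
lemmas V_lower = contracting_conds[THEN conjunct1]
lemmas V_diag = contracting_conds[THEN conjunct2, THEN conjunct2, THEN conjunct2, THEN conjunct1, rule_format]
lemmas V_loop = contracting_conds[THEN conjunct2, THEN conjunct2, THEN conjunct2, THEN conjunct2,
    THEN conjunct1, rule_format]
lemmas V_loop_strict = contracting_conds[THEN conjunct2, THEN conjunct2, THEN conjunct2, THEN conjunct2,
    THEN conjunct2, rule_format]

lemma V_nonneg: "0 \<le> V y"
proof -
  obtain k where k: "0 < k" "\<And>u v. k * (\<bar>u\<bar> + \<bar>v\<bar>) \<le> V (u, v)"
    using V_lower by blast
  obtain u v where y: "y = (u, v)" by (cases y)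
  have "0 \<le> k * (\<bar>u\<bar> + \<bar>v\<bar>)" using k(1) by simp
  also have "\<dots> \<le> V y" unfolding y by (rule k(2))
  finally show ?thesis .
qed

lemma stays_pos: "0 < d (2 * i + 1) - d (2 * i)" "0 < d (2 * i + 2) - d (2 * i + 1)"
  using strict_monoD[OF mono, of "2 * i" "2 * i + 1"] strict_monoD[OF mono, of "2 * i + 1" "2 * i + 2"]
  by simp_all

lemma loop_map:
  "Y (d (2 * i + 2)) = diag_flow p q (d (2 * i + 2) - d (2 * i + 1))
     (shear_flow n a c (d (2 * i + 1) - d (2 * i)) (Y (d (2 * i))))"
proof -
  have "Y (d (2 * i + 1)) = shear_flow n a c (d (2 * i + 1) - d (2 * i)) (Y (d (2 * i)))"
    using stays_pos(1)[of i] by (intro shear) linarith+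
  moreover have "Y (d (2 * i + 2)) = diag_flow p q (d (2 * i + 2) - d (2 * i + 1)) (Y (d (2 * i + 1)))"
    using stays_pos(2)[of i] by (intro diag) linarith+
  ultimately show ?thesis by (simp only:)
qed

lemma V_decseq: "decseq (\<lambda>i. V (Y (d (2 * i))))"
proof (rule decseq_SucI)
  fix i
  have "V (Y (d (2 * i + 2))) \<le> V (Y (d (2 * i)))"
    unfolding loop_map using stays_pos[of i] dwell[of i] by (intro V_loop conjI) auto
  then show "V (Y (d (2 * Suc i))) \<le> V (Y (d (2 * i)))" by simp
qed

text \<open>The values at loop starts decrease. Within a loop the shear costs at most the factor
  \<open>B\<close>, and the diagonal flow costs nothing further.\<close>

lemma V_bound:
  assumes B: "\<And>t y. 0 \<le> t \<Longrightarrow> V (shear_flow n a c t y) \<le> B * V y" and "0 < B"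
    and t: "d (2 * m) \<le> t"
  shows "V (Y t) \<le> B * V (Y (d (2 * m)))"
proof -
  obtain k where k: "2 * m \<le> k" "d k \<le> t" "t < d (Suc k)"
    using dwell_interval[OF t unbounded] by blast
  define i where "i = k div 2"
  have "V (Y t) \<le> B * V (Y (d (2 * i)))"
  proof (cases "even k")
    case True
    then have "k = 2 * i" by (simp add: i_def)
    then have "d (2 * i) \<le> t" "t \<le> d (2 * i + 1)" using k by auto
    then show ?thesis using B[of "t - d (2 * i)" "Y (d (2 * i))"] by (simp only: shear diff_ge_0_iff_ge)
  next
    case False
    then have ki: "k = 2 * i + 1" by (simp add: i_def)
    then have t: "d (2 * i + 1) \<le> t" "t \<le> d (2 * i + 2)" using k by auto
    then have "V (Y t) \<le> V (Y (d (2 * i + 1)))" using V_diag[of "t - d (2 * i + 1)" "Y (d (2 * i + 1))"]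
      by (simp only: diag diff_ge_0_iff_ge)
    also have "\<dots> \<le> B * V (Y (d (2 * i)))"
    proof -
      have "Y (d (2 * i + 1)) = shear_flow n a c (d (2 * i + 1) - d (2 * i)) (Y (d (2 * i)))"
        using stays_pos(1)[of i] by (intro shear) linarith+
      then show ?thesis
        using B[of "d (2 * i + 1) - d (2 * i)" "Y (d (2 * i))"] stays_pos(1)[of i] by simp
    qed
    finally show ?thesis .
  qed
  also have "\<dots> \<le> B * V (Y (d (2 * m)))"
  proof -
    have "m \<le> i" using k(1) by (simp add: i_def)
    then show ?thesis using V_decseq \<open>0 < B\<close> by (simp add: decseq_def)
  qed
  finally show ?thesis .
qed

text \<open>The decreasing values at loop starts have a limit \<open>L\<close>. Infinitely many
  loops share the factor \<open>\<rho>\<close>, and the limit along them gives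
  \<open>L \<le> \<rho> * L\<close>.\<close>

lemma V_tendsto_0:
  assumes "0 < \<eta>"
    and inf: "infinite {i. \<tau> + \<eta> \<le> d (2 * i + 1) - d (2 * i) \<or> \<tau> + \<eta> \<le> d (2 * i + 2) - d (2 * i + 1)}"
      (is "infinite ?I")
  shows "(\<lambda>i. V (Y (d (2 * i)))) \<longlonglongrightarrow> 0"
proof -
  let ?v = "\<lambda>i. V (Y (d (2 * i)))"
  obtain \<rho> where \<rho>: "0 \<le> \<rho>" "\<rho> < 1" and contr: "\<And>t s y. 0 < t \<Longrightarrow> 0 < s \<Longrightarrow> \<tau> \<le> t \<Longrightarrow> \<tau> \<le> s \<Longrightarrow>
      \<tau> + \<eta> \<le> t \<or> \<tau> + \<eta> \<le> s \<Longrightarrow> V (diag_flow p q s (shear_flow n a c t y)) \<le> \<rho> * V y"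
    using V_loop_strict[OF \<open>0 < \<eta>\<close>] by auto
  obtain L where L: "?v \<longlonglongrightarrow> L"
    using decseq_convergent[OF V_decseq, of 0] V_nonneg by blast
  have "0 \<le> L" by (rule LIMSEQ_le_const[OF L]) (blast intro: V_nonneg)
  have "?v (Suc (enumerate ?I k)) \<le> \<rho> * ?v (enumerate ?I k)" for k
  proof -
    define i where "i = enumerate ?I k"
    have "i \<in> ?I" unfolding i_def by (rule enumerate_in_set[OF inf])
    then have "V (Y (d (2 * i + 2))) \<le> \<rho> * V (Y (d (2 * i)))"
      unfolding loop_map using stays_pos[of i] dwell[of i] by (intro contr) auto
    then show ?thesis by (simp add: i_def)
  qed
  moreover have "(\<lambda>k. ?v (Suc (enumerate ?I k))) \<longlonglongrightarrow> L"
    using LIMSEQ_subseq_LIMSEQ[OF LIMSEQ_Suc[OF L] strict_mono_enumerate[OF inf]] by (simp add: o_def)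
  moreover have "(\<lambda>k. \<rho> * ?v (enumerate ?I k)) \<longlonglongrightarrow> \<rho> * L"
    using LIMSEQ_subseq_LIMSEQ[OF L strict_mono_enumerate[OF inf]]
    by (intro tendsto_mult_left) (simp add: o_def)
  ultimately have "L \<le> \<rho> * L" by (intro LIMSEQ_le) auto
  then have "(1 - \<rho>) * L \<le> 0" by (simp add: algebra_simps)
  then have "L = 0" using \<rho> \<open>0 \<le> L\<close> by (simp add: mult_le_0_iff)
  then show ?thesis using L by simp
qed

end

section \<open>Stability of the switched system\<close>

lemma coordinate_derivative:
  fixes Q B S :: "real^2^2" and x :: "real \<Rightarrow> real^2"
  assumes x: "(x has_vector_derivative B *v x t) (at t)" and conj: "Q ** B = S ** Q"
  shows "((\<lambda>t. (Q *v x t) $ i) has_real_derivative (S *v (Q *v x t)) $ i) (at t)"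
proof -
  have "((\<lambda>t. Q *v x t) has_vector_derivative Q *v (B *v x t)) (at t)"
    by (rule bounded_linear.has_vector_derivative[OF matrix_vector_mul_bounded_linear x])
  moreover have "Q *v (B *v x t) = S *v (Q *v x t)"
    by (simp add: matrix_vector_mul_assoc conj)
  ultimately have "((\<lambda>t. Q *v x t) has_vector_derivative S *v (Q *v x t)) (at t)" by simp
  from bounded_linear.has_vector_derivative[OF bounded_linear_vec_nth this, of i]
  show ?thesis by (simp add: has_real_derivative_iff_has_vector_derivative)
qed

lemma invertible_matrix_inv:
  fixes B :: "real^'n^'n"
  assumes "invertible B"
  shows "B ** matrix_inv B = mat 1" "matrix_inv B ** B = mat 1"
  using someI_ex[OF assms[unfolded invertible_def]] by (simp_all add: matrix_inv_def)

context
  fixes A :: "nat \<Rightarrow> real^2^2" and P Q :: "real^2^2" and n p q a c \<tau> :: real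
    and V :: "real \<times> real \<Rightarrow> real" and \<sigma> :: "real \<Rightarrow> nat" and d :: "nat \<Rightarrow> real"
  assumes inverse: "P ** Q = mat 1"
    and conj1: "Q ** A 1 = vector [vector [- n - a * c, a\<^sup>2], vector [- c\<^sup>2, - n + a * c]] ** Q"
    and conj2: "Q ** A 2 = vector [vector [- p, 0], vector [0, - q]] ** Q"
    and contr: "loop_contracting n p q a c \<tau> V"
    and sig: "signal_with \<sigma> d"
    and dwell: "\<And>j. 1 \<le> j \<Longrightarrow> \<tau> \<le> stay1 d j \<and> \<tau> \<le> stay2 d j"
begin

definition coords :: "(real \<Rightarrow> real^2) \<Rightarrow> real \<Rightarrow> real \<times> real" where
  "coords x t = ((Q *v x t) $ 1, (Q *v x t) $ 2)"

lemma signal_facts: "d 0 = 0" "strict_mono d" "filterlim d at_top sequentially"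
    "{t. 0 < t \<and> \<not> isCont \<sigma> t} = d ` {1..}"
  using sig unfolding signal_with_def by blast+

lemma switching_time_nonneg: "0 \<le> d k"
  using strict_mono_less_eq[OF signal_facts(2), of 0 k] signal_facts(1) by simp

text \<open>Dwell times are numbered from 1, loops of a trajectory from 0.\<close>

lemma stay1_Suc: "stay1 d (Suc i) = d (2 * i + 1) - d (2 * i)"
  and stay2_Suc: "stay2 d (Suc i) = d (2 * i + 2) - d (2 * i + 1)"
  by (simp_all add: stay1_def stay2_def)

lemma solution_derivative:
  assumes sol: "solution A \<sigma> x" and t: "d k < t" "t < d (Suc k)"
  shows "(x has_vector_derivative A (if even k then 1 else 2) *v x t) (at t)"
proof -
  have "t \<notin> d ` {1..}"
  proof
    assume "t \<in> d ` {1..}"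
    then obtain m where "t = d m" by blast
    then have "k < m" "m < Suc k" using t by (simp_all add: strict_mono_less[OF signal_facts(2)])
    then show False by simp
  qed
  moreover have "0 < t" using switching_time_nonneg[of k] t by simp
  ultimately have "isCont \<sigma> t" using signal_facts(4) by blast
  then have "(x has_vector_derivative A (\<sigma> t) *v x t) (at t)"
    using sol \<open>0 < t\<close> unfolding solution_def by blast
  then show ?thesis using signal_with_value[OF sig, of k t] t by simp
qed

lemma coords_trajectory:
  assumes sol: "solution A \<sigma> x"
  shows "loop_trajectory n p q a c \<tau> V d (coords x)"
proof
  show "loop_contracting n p q a c \<tau> V" "strict_mono d" "filterlim d at_top sequentially"
    by (fact contr signal_facts)+
  show "\<tau> \<le> d (2 * i + 1) - d (2 * i) \<and> \<tau> \<le> d (2 * i + 2) - d (2 * i + 1)" for i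
    using dwell[of "Suc i"] by (simp only: stay1_Suc stay2_Suc)
  have cont: "continuous_on {d k..t} (\<lambda>t. (Q *v x t) $ i)" for k t i
  proof -
    have "continuous_on {0..} x" using sol by (simp add: solution_def)
    then have "continuous_on {d k..t} x"
      using switching_time_nonneg[of k] by (rule_tac continuous_on_subset) auto
    then show ?thesis
      by (intro continuous_on_component bounded_linear.continuous_on[OF matrix_vector_mul_bounded_linear])
  qed
  show "coords x t = shear_flow n a c (t - d (2 * i)) (coords x (d (2 * i)))"
    if t: "d (2 * i) \<le> t" "t \<le> d (2 * i + 1)" for i t
    unfolding coords_def
  proof (rule shear_flow_unique[OF t(1) cont cont])
    fix s assume s: "d (2 * i) < s" "s < t"
    have "(x has_vector_derivative A 1 *v x s) (at s)"
      using solution_derivative[OF sol, of "2 * i" s] s t by simp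
    note D = coordinate_derivative[OF this conj1]
    show "((\<lambda>t. (Q *v x t) $ 1) has_real_derivative - n * (Q *v x s) $ 1 +
        (a * (Q *v x s) $ 2 - c * (Q *v x s) $ 1) * a) (at s)"
      using D[of 1] by (simp add: matrix_vector_mult_def[of "vector _"] sum_2 power2_eq_square algebra_simps)
    show "((\<lambda>t. (Q *v x t) $ 2) has_real_derivative - n * (Q *v x s) $ 2 +
        (a * (Q *v x s) $ 2 - c * (Q *v x s) $ 1) * c) (at s)"
      using D[of 2] by (simp add: matrix_vector_mult_def[of "vector _"] sum_2 power2_eq_square algebra_simps)
  qed
  show "coords x t = diag_flow p q (t - d (2 * i + 1)) (coords x (d (2 * i + 1)))"
    if t: "d (2 * i + 1) \<le> t" "t \<le> d (2 * i + 2)" for i t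
    unfolding coords_def
  proof (rule diag_flow_unique[OF t(1) cont cont])
    fix s assume s: "d (2 * i + 1) < s" "s < t"
    have "(x has_vector_derivative A 2 *v x s) (at s)"
      using solution_derivative[OF sol, of "2 * i + 1" s] s t by simp
    note D = coordinate_derivative[OF this conj2]
    show "((\<lambda>t. (Q *v x t) $ 1) has_real_derivative - p * (Q *v x s) $ 1) (at s)"
      using D[of 1] by (simp add: matrix_vector_mult_def[of "vector _"] sum_2)
    show "((\<lambda>t. (Q *v x t) $ 2) has_real_derivative - q * (Q *v x s) $ 2) (at s)"
      using D[of 2] by (simp add: matrix_vector_mult_def[of "vector _"] sum_2)
  qed
qed

lemma coords_equivalent_norm:
  obtains k K where "0 < k" "0 < K" "\<And>x t. k * norm (x t) \<le> V (coords x t)"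
    "\<And>x t. V (coords x t) \<le> K * norm (x t)"
proof -
  obtain k where k: "0 < k" "\<And>u v. k * (\<bar>u\<bar> + \<bar>v\<bar>) \<le> V (u, v)"
    using contr[unfolded loop_contracting_def, THEN conjunct1] by blast
  obtain K where K: "0 < K" "\<And>u v. V (u, v) \<le> K * (\<bar>u\<bar> + \<bar>v\<bar>)"
    using contr[unfolded loop_contracting_def, THEN conjunct2, THEN conjunct1] by blast
  obtain BP where BP: "0 < BP" "\<And>y. norm (P *v y) \<le> BP * norm y"
    using linear_bounded_pos[of "(*v) P"] by auto
  obtain BQ where BQ: "0 < BQ" "\<And>y. norm (Q *v y) \<le> BQ * norm y"
    using linear_bounded_pos[of "(*v) Q"] by auto
  show ?thesis
  proof
    show "0 < k / BP" "0 < K * (2 * BQ)" using k(1) K(1) BP(1) BQ(1) by simp_all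
    fix x :: "real \<Rightarrow> real^2" and t
    have "x t = P *v (Q *v x t)" by (simp add: matrix_vector_mul_assoc inverse)
    then have "norm (x t) \<le> BP * norm (Q *v x t)" using BP(2) by metis
    also have "norm (Q *v x t) \<le> \<bar>(Q *v x t) $ 1\<bar> + \<bar>(Q *v x t) $ 2\<bar>"
      using norm_le_l1_cart[of "Q *v x t"] by (simp add: sum_2)
    finally have "k * norm (x t) \<le> k * (BP * (\<bar>(Q *v x t) $ 1\<bar> + \<bar>(Q *v x t) $ 2\<bar>))"
      using k(1) BP(1) by (simp add: mult_left_mono)
    also have "\<dots> \<le> BP * V (coords x t)"
      using mult_left_mono[OF k(2) less_imp_le[OF BP(1)]] by (simp add: coords_def mult_ac)
    finally show "k / BP * norm (x t) \<le> V (coords x t)" using BP(1) by (simp add: field_simps)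
    have "\<bar>(Q *v x t) $ i\<bar> \<le> BQ * norm (x t)" for i
      using component_le_norm_cart[of "Q *v x t" i] BQ(2)[of "x t"] by linarith
    from add_mono[OF this[of 1] this[of 2]]
    have "\<bar>(Q *v x t) $ 1\<bar> + \<bar>(Q *v x t) $ 2\<bar> \<le> 2 * BQ * norm (x t)" by simp
    from mult_left_mono[OF this less_imp_le[OF K(1)]]
    show "V (coords x t) \<le> K * (2 * BQ) * norm (x t)"
      using K(2)[of "(Q *v x t) $ 1" "(Q *v x t) $ 2"] by (simp add: coords_def mult_ac)
  qed
qed

lemma shear_bound_obtain:
  obtains B where "0 < B" "\<And>t y. 0 \<le> t \<Longrightarrow> V (shear_flow n a c t y) \<le> B * V y"
  using contr[unfolded loop_contracting_def, THEN conjunct2, THEN conjunct2, THEN conjunct1] by blast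

lemma loop_contracting_imp_stable: "switched_stable A \<sigma>"
  unfolding switched_stable_def
proof (intro allI impI)
  fix \<epsilon> :: real assume "0 < \<epsilon>"
  obtain B where B: "0 < B" "\<And>t y. 0 \<le> t \<Longrightarrow> V (shear_flow n a c t y) \<le> B * V y"
    by (rule shear_bound_obtain) blast
  obtain k K where kK: "0 < k" "0 < K" "\<And>x t. k * norm (x t) \<le> V (coords x t)"
    "\<And>x t. V (coords x t) \<le> K * norm (x t)" by (rule coords_equivalent_norm) blast
  show "\<exists>\<delta>>0. \<forall>x. solution A \<sigma> x \<and> norm (x 0) < \<delta> \<longrightarrow> (\<forall>t>0. norm (x t) < \<epsilon>)"
  proof (intro exI conjI allI impI)
    show "0 < k * \<epsilon> / (B * K)" using kK B \<open>0 < \<epsilon>\<close> by simp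
    fix x and t :: real
    assume x: "solution A \<sigma> x \<and> norm (x 0) < k * \<epsilon> / (B * K)" and t: "0 < t"
    interpret loop_trajectory n p q a c \<tau> V d "coords x" using coords_trajectory x by blast
    have "k * norm (x t) \<le> V (coords x t)" by (rule kK(3))
    also have "\<dots> \<le> B * V (coords x 0)"
      using V_bound[OF B(2,1), of 0 t] t signal_facts(1) by simp
    also have "\<dots> \<le> B * (K * norm (x 0))" using B(1) kK(4) by (intro mult_left_mono) auto
    also have "\<dots> < k * \<epsilon>" using x B(1) kK(2) by (simp add: field_simps)
    finally show "norm (x t) < \<epsilon>" using kK(1) by simp
  qed
qed

lemma loop_contracting_imp_attractive:
  assumes \<Gamma>: "\<Gamma> \<subseteq> {1..}" "infinite \<Gamma>"
    and nocluster: "\<not> cluster_point_along \<Gamma> (\<lambda>j. (stay1 d j, stay2 d j)) (\<tau>, \<tau>)"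
    and sol: "solution A \<sigma> x"
  shows "((\<lambda>t. norm (x t)) \<longlongrightarrow> 0) at_top"
proof -
  interpret loop_trajectory n p q a c \<tau> V d "coords x" using coords_trajectory sol by blast
  obtain B where B: "0 < B" "\<And>t y. 0 \<le> t \<Longrightarrow> V (shear_flow n a c t y) \<le> B * V y"
    by (rule shear_bound_obtain) blast
  obtain k K where kK: "0 < k" "0 < K" "\<And>x t. k * norm (x t) \<le> V (coords x t)"
    "\<And>x t. V (coords x t) \<le> K * norm (x t)" by (rule coords_equivalent_norm) blast
  obtain U where U: "open U" "(\<tau>, \<tau>) \<in> U" "finite {j \<in> \<Gamma>. (stay1 d j, stay2 d j) \<in> U}"
    using nocluster unfolding cluster_point_along_def by blast
  obtain X Z where XZ: "open X" "open Z" "(\<tau>, \<tau>) \<in> X \<times> Z" "X \<times> Z \<subseteq> U"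
    using open_prod_elim[OF U(1,2)] by blast
  \<comment> \<open>A square of half-width \<open>\<eta>\<close> around
    \<open>(\<tau>, \<tau>)\<close> fits into \<open>U\<close>. Both dwell times are at least
    \<open>\<tau>\<close>, so a pair outside \<open>U\<close> has one of them at least
    \<open>\<tau> + \<eta>\<close>; this holds for all but finitely many indices in
    \<open>\<Gamma>\<close>.\<close>
  have "open (X \<inter> Z)" "\<tau> \<in> X \<inter> Z" using XZ by auto
  then obtain \<eta> where \<eta>: "0 < \<eta>" "\<And>r. dist r \<tau> < \<eta> \<Longrightarrow> r \<in> X \<inter> Z"
    unfolding open_dist by blast
  let ?I = "{i. \<tau> + \<eta> \<le> d (2 * i + 1) - d (2 * i) \<or> \<tau> + \<eta> \<le> d (2 * i + 2) - d (2 * i + 1)}"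
  have "infinite (\<Gamma> - {j \<in> \<Gamma>. (stay1 d j, stay2 d j) \<in> U})"
    using \<Gamma>(2) U(3) by (simp add: Diff_infinite_finite)
  moreover have "\<Gamma> - {j \<in> \<Gamma>. (stay1 d j, stay2 d j) \<in> U} \<subseteq> Suc ` ?I"
  proof
    fix j assume j: "j \<in> \<Gamma> - {j \<in> \<Gamma>. (stay1 d j, stay2 d j) \<in> U}"
    then have "1 \<le> j" using \<Gamma>(1) by auto
    then obtain i where i: "j = Suc i" by (cases j) auto
    have "\<not> (stay1 d j \<in> X \<inter> Z \<and> stay2 d j \<in> X \<inter> Z)" using j XZ(4) by blast
    then have "\<not> (dist (stay1 d j) \<tau> < \<eta> \<and> dist (stay2 d j) \<tau> < \<eta>)" using \<eta>(2) by blast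
    then have "i \<in> ?I"
      using dwell[of i] unfolding i stay1_Suc stay2_Suc dist_real_def by auto
    then show "j \<in> Suc ` ?I" using i by blast
  qed
  ultimately have "infinite (Suc ` ?I)" using infinite_super by blast
  then have "infinite ?I" using finite_imageI by blast
  then have lim: "(\<lambda>i. V (coords x (d (2 * i)))) \<longlonglongrightarrow> 0" by (rule V_tendsto_0[OF \<eta>(1)])
  show ?thesis
  proof (rule tendstoI)
    fix \<epsilon> :: real assume "0 < \<epsilon>"
    then have "0 < k * \<epsilon> / B" using kK(1) B(1) by simp
    from eventually_happens[OF order_tendstoD(2)[OF lim this]]
    obtain m where m: "V (coords x (d (2 * m))) < k * \<epsilon> / B" by auto
    have "norm (x t) < \<epsilon>" if "d (2 * m) \<le> t" for t
    proof -
      have "k * norm (x t) \<le> V (coords x t)" by (rule kK(3))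
      also have "\<dots> \<le> B * V (coords x (d (2 * m)))" by (rule V_bound[OF B(2,1) that])
      also have "\<dots> < k * \<epsilon>" using m B(1) by (simp add: field_simps)
      finally show ?thesis using kK(1) by simp
    qed
    then show "\<forall>\<^sub>F t in at_top. dist (norm (x t)) 0 < \<epsilon>"
      unfolding eventually_at_top_linorder by auto
  qed
qed

end

section \<open>Choice of the norm by the size and sign of \<open>a * c\<close>, and
  conclusion\<close>

lemma loop_contracting_tau21:
  assumes "0 < n" "0 < p" "p < q"
  shows "\<exists>V. loop_contracting n p q a c (tau21 a c n p q) V"
proof (cases "\<bar>a * c\<bar> \<le> n")
  case True
  then show ?thesis
    using weighted_max_norm_loop_contracting[OF assms] by (simp add: tau21_def)
next
  case False
  then have less: "n < \<bar>a * c\<bar>" by simp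
  note tau = tau21_bound[OF assms less]
  show ?thesis
  proof (cases "0 < a * c")
    case True
    then show ?thesis
      using tau(2) by (intro hexagon_norm_loop_contracting[OF assms tau(1) _ True, of 1]) auto
  next
    case False
    then have neg: "a * c < 0" using less assms by auto
    then show ?thesis
      using tau(2) by (intro cone_norm_loop_contracting[OF assms tau(1) _ neg, of "- 1"]) auto
  qed
qed

theorem theorem8p3:
  fixes A :: "nat \<Rightarrow> real^2^2" and P1 P2 :: "real^2^2"
    and n1 p2 q2 a b c d :: real
  assumes "0 < n1" and "0 < p2" and "p2 < q2"
    and "invertible P1" and "invertible P2"
    and "A 1 = P1 ** vector [vector [- n1, 1], vector [0, - n1]] ** matrix_inv P1"
    and "A 2 = P2 ** vector [vector [- p2, 0], vector [0, - q2]] ** matrix_inv P2"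
    and "matrix_inv P2 ** P1 = vector [vector [a, b], vector [c, d]]"
    and "det (matrix_inv P2 ** P1) = 1"
  shows "(\<bar>a * c\<bar> \<le> n1 \<longrightarrow> (\<forall>\<sigma>\<in>signals. switched_stable A \<sigma>)) \<and>
    (n1 < \<bar>a * c\<bar> \<longrightarrow>
       (\<exists>!z. crit_pair a c n1 p2 q2 z) \<and>
       (\<forall>t0 s0. crit_pair a c n1 p2 q2 (t0, s0) \<and> t0 < s0 \<longrightarrow>
          (\<exists>!t. diag_root a c n1 p2 q2 t0 t))) \<and>
    0 \<le> tau21 a c n1 p2 q2 \<and>
    (\<forall>\<sigma>\<in>dwell_signals (tau21 a c n1 p2 q2). switched_stable A \<sigma>) \<and>
    (\<forall>\<sigma>\<in>dwell_signals' (tau21 a c n1 p2 q2). asymptotically_stable A \<sigma>)"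
proof -
  let ?Q = "matrix_inv P2" and ?\<tau> = "tau21 a c n1 p2 q2"
  let ?M = "vector [vector [a, b], vector [c, d]] :: real^2^2"
  let ?J = "vector [vector [- n1, 1], vector [0, - n1]] :: real^2^2"
  \<comment> \<open>This is \<open>?J\<close> conjugated by \<open>?M\<close> of determinant 1:
    \<open>- n1\<close> times the identity plus a nilpotent matrix whose image and kernel, when
    nonzero, are both spanned by \<open>(a, c)\<close>.\<close>
  let ?S = "vector [vector [- n1 - a * c, a\<^sup>2], vector [- c\<^sup>2, - n1 + a * c]] :: real^2^2"
  have inv2: "P2 ** ?Q = mat 1" "?Q ** P2 = mat 1" and inv1: "P1 ** matrix_inv P1 = mat 1"
    using invertible_matrix_inv[OF \<open>invertible P2\<close>] invertible_matrix_inv[OF \<open>invertible P1\<close>] by auto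
  have det: "a * d - b * c = 1" using assms(9) unfolding assms(8) by (simp add: det_2)
  have MJ: "?M ** ?J = ?S ** ?M"
  proof -
    have "a * (a * d) = a + a * (b * c)" "c * (a * d) = c + c * (b * c)"
      using det by (simp_all add: algebra_simps)
    then show ?thesis
      by (simp add: vec_eq_iff forall_2 matrix_matrix_mult_def sum_2 power2_eq_square algebra_simps)
  qed
  have "?Q ** A 1 = (?Q ** P1 ** ?J) ** matrix_inv P1"
    unfolding assms(6) by (simp only: matrix_mul_assoc)
  also have "?Q ** P1 ** ?J = ?S ** (?Q ** P1)" unfolding assms(8) by (rule MJ)
  also have "?S ** (?Q ** P1) ** matrix_inv P1 = ?S ** ?Q ** (P1 ** matrix_inv P1)"
    by (simp only: matrix_mul_assoc)
  finally have conj1: "?Q ** A 1 = ?S ** ?Q" by (simp add: inv1)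
  have conj2: "?Q ** A 2 = vector [vector [- p2, 0], vector [0, - q2]] ** ?Q"
    unfolding assms(7) by (simp add: matrix_mul_assoc inv2)
  obtain V where V: "loop_contracting n1 p2 q2 a c ?\<tau> V"
    using loop_contracting_tau21[OF assms(1-3)] by blast
  note stable = loop_contracting_imp_stable[OF inv2(1) conj1 conj2 V]
  note attractive = loop_contracting_imp_attractive[OF inv2(1) conj1 conj2 V]
  have S: "switched_stable A \<sigma>" if "\<sigma> \<in> dwell_signals ?\<tau>" for \<sigma>
    using that stable unfolding dwell_signals_def by blast
  have AS: "asymptotically_stable A \<sigma>" if "\<sigma> \<in> dwell_signals' ?\<tau>" for \<sigma>
  proof -
    from that have mem: "\<sigma> \<in> dwell_signals ?\<tau>" by (simp add: dwell_signals'_def)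
    then obtain f where f: "signal_with \<sigma> f"
      "\<And>j. 1 \<le> j \<Longrightarrow> ?\<tau> \<le> stay1 f j \<and> ?\<tau> \<le> stay2 f j"
      unfolding dwell_signals_def by blast
    from that obtain f' \<Gamma> where f': "signal_with \<sigma> f'" "\<Gamma> \<subseteq> {1..}" "infinite \<Gamma>"
      "\<not> cluster_point_along \<Gamma> (\<lambda>j. (stay1 f' j, stay2 f' j)) (?\<tau>, ?\<tau>)"
      unfolding dwell_signals'_def by blast
    have "f' = f" by (rule signal_with_unique[OF f'(1) f(1)])
    then show ?thesis
      using attractive[OF f f'(2,3)] f'(4) S[OF mem] unfolding asymptotically_stable_def by blast
  qed
  have "switched_stable A \<sigma>" if small: "\<bar>a * c\<bar> \<le> n1" and mem: "\<sigma> \<in> signals" for \<sigma>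
  proof (rule S)
    have \<tau>: "?\<tau> = 0" using small by (simp add: tau21_def)
    obtain f where f: "signal_with \<sigma> f" using mem unfolding signals_def by blast
    then have "strict_mono f" by (simp add: signal_with_def)
    \<comment> \<open>This includes \<open>j = 0\<close>, where truncated subtraction makes both
      stays 0.\<close>
    then have "0 \<le> stay1 f j \<and> 0 \<le> stay2 f j" for j
      by (simp add: stay1_def stay2_def strict_mono_less_eq)
    then show "\<sigma> \<in> dwell_signals ?\<tau>" unfolding dwell_signals_def \<tau> using f by blast
  qed
  moreover have "0 \<le> ?\<tau>"
    using tau21_bound(1)[OF assms(1-3), of a c] by (cases "\<bar>a * c\<bar> \<le> n1") (auto simp: tau21_def)
  moreover have "\<exists>!z. crit_pair a c n1 p2 q2 z" if "n1 < \<bar>a * c\<bar>"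
    by (rule crit_pair_ex1[OF assms(1-3) that])
  moreover have "\<exists>!t. diag_root a c n1 p2 q2 t0 t"
    if "n1 < \<bar>a * c\<bar>" "crit_pair a c n1 p2 q2 (t0, s0)" "t0 < s0" for t0 s0
    by (rule diag_root_ex1[OF assms(1-3) that])
  ultimately show ?thesis using S AS by blast
qed

end
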